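(* Let $n\ge 5$. (1) The number $|G(n,n-5)/Z_n|$ of cyclic equivalence classes of $(n-5)$-dissections of a convex regular $n$-gon is \[ \frac{(n-3)^2(n-4)}{4n(2n-5)}C_{n-2}+\frac{n-4}{8}C_{n/2-1}+\frac{4}{5}C_{n/5-1}. \] (2) The number $|G(n,n-5)/D_{2n}|$ of dihedral equivalence classes of $(n-5)$-dissections of a convex regular $n$-gon is \[ \frac{(n-3)^2(n-4)}{8n(2n-5)}C_{n-2}+\frac{2}{5}C_{n/5-1}+\frac{3(n-4)(n-1)}{16(n-3)}C_{n/2-1} \] if $n$ is even, and \[ \frac{(n-3)^2(n-4)}{8n(2n-5)}C_{n-2}+\frac{2}{5}C_{n/5-1}+\frac{n^2-2n-11}{8(n-4)}C_{(n-3)/2} \] if $n$ is odd.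
   Context: For $n\ge 3$ and $0\le k\le n-3$, a $k$-dissection of a convex regular $n$-gon is a partition of it into $k+1$ polygons by $k$ pairwise non-crossing diagonals; $G(n,k)$ denotes the set of $k$-dissections (vertices labelled $0,\dots,n-1$ in cyclic order). The cyclic group $Z_n$ (rotations) and the dihedral group $D_{2n}$ (rotations and reflections of the polygon) act on $G(n,k)$; $G(n,k)/Z_n$ and $G(n,k)/D_{2n}$ are the sets of orbits. For real $m$, $C_m=\frac{1}{m+1}\binom{2m}{m}$ if $m$ is a nonnegative integer and $C_m=0$ otherwise. *)

theory Defs
  imports Complex_Main "HOL-Algebra.Group_Action"
begin

text \<open>The vertices of the \<open>n\<close>-gon are \<open>0, \<dots>, n - 1\<close> in cyclic order; a diagonal is the set of
  its two end points, and a dissection is the set of its diagonals.\<close>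

definition diagonals :: "nat \<Rightarrow> nat set set" where
  "diagonals n = {{i, j} | i j. i < n \<and> j < n \<and> i \<noteq> j \<and> j \<noteq> (i + 1) mod n \<and> i \<noteq> (j + 1) mod n}"

text \<open>Two diagonals cross, i.e. meet in the interior of the polygon, iff their end points are four
  distinct vertices that alternate around the polygon.\<close>

definition crossing :: "nat set \<Rightarrow> nat set \<Rightarrow> bool" where
  "crossing d e \<longleftrightarrow>
     (\<exists>a b a' b'. a < b \<and> b < a' \<and> a' < b' \<and> {d, e} = {{a, a'}, {b, b'}})"

definition dissections :: "nat \<Rightarrow> nat \<Rightarrow> nat set set set" where
  "dissections n k =
     {D. D \<subseteq> diagonals n \<and> finite D \<and> card D = k \<and> pairwise (\<lambda>d e. \<not> crossing d e) D}"

definition rotation :: "nat \<Rightarrow> nat \<Rightarrow> nat \<Rightarrow> nat" where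
  "rotation n r = (\<lambda>i\<in>{..<n}. (i + r) mod n)"

text \<open>The reflection \<open>i \<mapsto> r - i\<close> modulo \<open>n\<close>; the subtraction does not truncate because \<open>i < n\<close>.\<close>

definition reflection :: "nat \<Rightarrow> nat \<Rightarrow> nat \<Rightarrow> nat" where
  "reflection n r = (\<lambda>i\<in>{..<n}. (r + n - i) mod n)"

text \<open>Both groups are realised as groups of permutations of the vertices.\<close>

definition rotation_group :: "nat \<Rightarrow> (nat \<Rightarrow> nat) monoid" where
  "rotation_group n = BijGroup {..<n} \<lparr>carrier := {rotation n r | r. r < n}\<rparr>"

definition dihedral_group :: "nat \<Rightarrow> (nat \<Rightarrow> nat) monoid" where
  "dihedral_group n =
     BijGroup {..<n} \<lparr>carrier := {rotation n r | r. r < n} \<union> {reflection n r | r. r < n}\<rparr>"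

definition dissection_action :: "nat \<Rightarrow> nat \<Rightarrow> (nat \<Rightarrow> nat) \<Rightarrow> nat set set \<Rightarrow> nat set set" where
  "dissection_action n k g = (\<lambda>D\<in>dissections n k. (`) g ` D)"

definition catalan :: "real \<Rightarrow> real" where
  "catalan m =
     (if m \<in> \<nat> then 1 / (m + 1) * real ((2 * nat \<lfloor>m\<rfloor>) choose nat \<lfloor>m\<rfloor>) else 0)"

end

theory Submission
  imports Defs "HOL-Computational_Algebra.Formal_Power_Series"
begin

text \<open>Burnside's lemma reduces both counts to dissections fixed by a rotation or a reflection. A
  dissection with \<open>n - 5\<close> diagonals is two short of a triangulation. A rotation of order \<open>d \<ge> 3\<close>
  fixing it permutes the diagonals freely, hence \<open>d\<close> divides both \<open>n\<close> and \<open>n - 5\<close> and \<open>d = 5\<close>; then a central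
  pentagon splits the polygon into five congruent triangulated sectors. For \<open>d = 2\<close> there is a
  unique diameter, by parity. A dissection fixed by a reflection is determined by one half of the
  polygon, where a diagonal perpendicular to the axis acts as a diagonal to one additional vertex. All
  these numbers are coefficients of the series \<open>Y\<^sub>\<delta>\<close> counting non-crossing sets of chords on \<open>L + 1\<close>
  vertices, base \<open>(0, L)\<close> allowed, that are \<open>\<delta>\<close> short of the maximum; \<open>Y = \<Sum>\<^sub>\<delta> Y\<^sub>\<delta> t\<^sup>\<delta>\<close> satisfies
  \<open>Y = X + Y\<^sup>2 + t X Y\<close>.\<close>

unbundle fps_syntax

section \<open>Non-crossing sets of chords\<close>

text \<open>Diagonals are encoded as increasing pairs, so that crossing and lying on one side become
  inequalities that linear arithmetic decides; the price is a case distinction whenever a symmetry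
  carries an end point past vertex 0. The closed forms need no expansion of a square root: the
  derivative of Y_0 is the inverse of 1 - 2 Y_0, so Y_1 and Y_2 become polynomials in X and this
  derivative. For a reflection, doubling the half does not double the number of diagonals, since
  those perpendicular to the axis count once. Their number p and the shortfall \<delta> of the half
  are tied by a linear equation such as p + 2\<delta> = 2, with very few solutions. This is why the
  counts are refined by the number of chords at the last vertex; the same refinement drives the
  recursion, which removes one chord of that fan at a time.\<close>

definition crosses :: "nat \<times> nat \<Rightarrow> nat \<times> nat \<Rightarrow> bool" where
  "crosses c d \<longleftrightarrow> fst c < fst d \<and> fst d < snd c \<and> snd c < snd d \<or>
                  fst d < fst c \<and> fst c < snd d \<and> snd d < snd c"

definition chords :: "nat \<Rightarrow> nat \<Rightarrow> (nat \<times> nat) set" where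
  "chords a b = {(i, j). a \<le> i \<and> i + 2 \<le> j \<and> j \<le> b}"

definition inner :: "nat \<Rightarrow> nat \<Rightarrow> (nat \<times> nat) set" where
  "inner a b = chords a b - {(a, b)}"

definition nc :: "(nat \<times> nat) set \<Rightarrow> (nat \<times> nat) set set" where
  "nc C = {D. D \<subseteq> C \<and> (\<forall>c\<in>D. \<forall>d\<in>D. \<not> crosses c d)}"

definition ending_at :: "nat \<Rightarrow> (nat \<times> nat) set \<Rightarrow> (nat \<times> nat) set" where
  "ending_at b D = {c \<in> D. snd c = b}"

lemma crosses_Pair:
  "crosses (i, j) (k, l) \<longleftrightarrow> i < k \<and> k < j \<and> j < l \<or> k < i \<and> i < l \<and> l < j"
  by (simp add: crosses_def)

lemma finite_chords [simp]: "finite (chords a b)"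
  by (rule finite_subset[of _ "{..b} \<times> {..b}"]) (auto simp: chords_def)

lemma finite_inner [simp]: "finite (inner a b)"
  by (simp add: inner_def)

lemma finite_nc: "finite C \<Longrightarrow> finite (nc C)"
  by (rule finite_subset[of _ "Pow C"]) (auto simp: nc_def)

lemma nc_finite: "finite C \<Longrightarrow> D \<in> nc C \<Longrightarrow> finite D"
  by (auto simp: nc_def intro: finite_subset)

lemma nc_subset: "D \<in> nc C \<Longrightarrow> D' \<subseteq> D \<Longrightarrow> D' \<subseteq> C' \<Longrightarrow> D' \<in> nc C'"
  unfolding nc_def by blast

lemma nc_not_crosses: "D \<in> nc C \<Longrightarrow> c \<in> D \<Longrightarrow> d \<in> D \<Longrightarrow> \<not> crosses c d"
  by (auto simp: nc_def)

lemma nc_chordsD: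
  "D \<in> nc (chords a b) \<Longrightarrow> c \<in> D \<Longrightarrow> a \<le> fst c \<and> fst c + 2 \<le> snd c \<and> snd c \<le> b"
  by (auto simp: nc_def chords_def)

lemma nc_innerD:
  "D \<in> nc (inner a b) \<Longrightarrow> c \<in> D \<Longrightarrow>
    a \<le> fst c \<and> fst c + 2 \<le> snd c \<and> snd c \<le> b \<and> c \<noteq> (a, b)"
  by (auto simp: nc_def chords_def inner_def)

lemma bij_betw_nc:
  assumes "bij_betw f C C'" "\<And>c d. c \<in> C \<Longrightarrow> d \<in> C \<Longrightarrow> crosses (f c) (f d) \<longleftrightarrow> crosses c d"
  shows "bij_betw ((`) f) (nc C) (nc C')"
proof -
  have inj: "inj_on f C" and im: "f ` C = C'"
    using assms(1) by (auto simp: bij_betw_def)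
  have "inj_on ((`) f) (nc C)"
    by (rule inj_onI) (metis (mono_tags, lifting) inj inj_on_image_eq_iff mem_Collect_eq nc_def)
  moreover have "(`) f ` nc C = nc C'"
  proof (intro equalityI subsetI)
    fix E assume "E \<in> (`) f ` nc C"
    then obtain D where D: "D \<in> nc C" "E = f ` D" by blast
    then have "D \<subseteq> C" by (simp add: nc_def)
    moreover have "\<not> crosses (f c) (f d)" if "c \<in> D" "d \<in> D" for c d
      using assms(2)[of c d] nc_not_crosses[OF D(1) that] that \<open>D \<subseteq> C\<close> by blast
    ultimately show "E \<in> nc C'" using D(2) im unfolding nc_def by blast
  next
    fix E assume E: "E \<in> nc C'"
    then obtain D where D: "D \<subseteq> C" "E = f ` D"
      using im by (auto simp: nc_def subset_image_iff)
    have "\<not> crosses c d" if "c \<in> D" "d \<in> D" for c d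
      using nc_not_crosses[OF E, of "f c" "f d"] that D assms(2)[of c d] by auto
    with D show "E \<in> (`) f ` nc C" by (auto simp: nc_def)
  qed
  ultimately show ?thesis by (simp add: bij_betw_def)
qed

lemma bij_betw_card_filter:
  assumes "bij_betw f A B" "\<And>x. x \<in> A \<Longrightarrow> Q (f x) \<longleftrightarrow> P x"
  shows "card {x \<in> A. P x} = card {y \<in> B. Q y}"
proof (rule bij_betw_same_card)
  show "bij_betw f {x \<in> A. P x} {y \<in> B. Q y}"
    using assms unfolding bij_betw_def inj_on_def by auto
qed

text \<open>The chord from \<open>b\<close> to the smallest possible vertex \<open>i\<close> separates the chords on \<open>a, \<dots>, i\<close>
  from those on \<open>i, \<dots>, b\<close>: there is nothing else at \<open>b\<close> on the left side.\<close>

lemma first_chord_decomposition: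
  "bij_betw (\<lambda>(i, D, E). D \<union> insert (i, b) E)
     (SIGMA i:{a<..<b - 1}. nc (chords a i) \<times> nc (inner i b))
     {D \<in> nc (inner a b). ending_at b D \<noteq> {}}"
  (is "bij_betw ?f ?A ?B")
proof (rule bij_betw_imageI)
  show "inj_on ?f ?A"
  proof (rule inj_onI, clarsimp)
    fix i D E i' D' E'
    assume i: "a < i" "i < b - Suc 0" "a < i'" "i' < b - Suc 0"
      and D: "D \<in> nc (chords a i)" and E: "E \<in> nc (inner i b)"
      and D': "D' \<in> nc (chords a i')" and E': "E' \<in> nc (inner i' b)"
      and eq: "insert (i, b) (D \<union> E) = insert (i', b) (D' \<union> E')"
    have "(i, b) \<in> insert (i', b) (D' \<union> E')" "(i', b) \<in> insert (i, b) (D \<union> E)"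
      using eq by blast+
    then have ii: "i' = i"
      using nc_chordsD[OF D, of "(i', b)"] nc_innerD[OF E, of "(i', b)"]
        nc_chordsD[OF D', of "(i, b)"] nc_innerD[OF E', of "(i, b)"] i by auto
    have "{c \<in> insert (i, b) (X \<union> Y). snd c \<le> i} = X \<and>
          {c \<in> insert (i, b) (X \<union> Y). i \<le> fst c \<and> c \<noteq> (i, b)} = Y"
      if "X \<in> nc (chords a i)" "Y \<in> nc (inner i b)" for X Y
      using i nc_chordsD[OF that(1)] nc_innerD[OF that(2)] by fastforce
    from this[of D E] this[of D' E'] show "i = i' \<and> D = D' \<and> E = E'"
      using D E D' E' eq ii by simp
  qed
  show "?f ` ?A = ?B"
  proof (intro equalityI subsetI)
    fix F assume "F \<in> ?f ` ?A"
    then obtain i D E where i: "a < i" "i < b - 1" and D: "D \<in> nc (chords a i)"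
      and E: "E \<in> nc (inner i b)" and F: "F = D \<union> insert (i, b) E" by auto
    have s: "D \<subseteq> chords a i" "E \<subseteq> inner i b" using D E by (auto simp: nc_def)
    have "\<not> crosses c d" if c: "c \<in> F" "d \<in> F" for c d
    proof -
      consider "c \<in> D" "d \<in> D" | "c \<in> E" "d \<in> E" | "c \<in> D" "d \<in> insert (i, b) E"
        | "d \<in> D" "c \<in> insert (i, b) E" | "c = (i, b)" "d \<in> insert (i, b) E"
        | "d = (i, b)" "c \<in> insert (i, b) E" using c F by auto
      then show ?thesis
      proof cases
        case 1 then show ?thesis using D nc_not_crosses by blast
      next
        case 2 then show ?thesis using E nc_not_crosses by blast
      qed (use i nc_chordsD[OF D, of c] nc_chordsD[OF D, of d] nc_innerD[OF E, of c]
          nc_innerD[OF E, of d] in \<open>auto simp: crosses_def\<close>)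
    qed
    moreover have "F \<subseteq> inner a b" using s i F by (auto simp: chords_def inner_def)
    moreover have "ending_at b F \<noteq> {}" using F by (auto simp: ending_at_def)
    ultimately show "F \<in> ?B" by (simp add: nc_def)
  next
    fix F assume "F \<in> ?B"
    then have F: "F \<in> nc (inner a b)" and ne: "ending_at b F \<noteq> {}" by auto
    have Fs: "F \<subseteq> inner a b" using F by (auto simp: nc_def)
    define i where "i = (LEAST i. (i, b) \<in> F)"
    obtain i0 where "(i0, b) \<in> F" using ne by (auto simp: ending_at_def)
    then have ib: "(i, b) \<in> F" unfolding i_def by (rule LeastI)
    have min: "i \<le> k" if "(k, b) \<in> F" for k
      using that unfolding i_def by (rule Least_le)
    have i: "a < i" "i < b - 1" using ib Fs by (force simp: chords_def inner_def)+
    define D where "D = {c \<in> F. snd c \<le> i}"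
    define E where "E = {c \<in> F. i \<le> fst c \<and> c \<noteq> (i, b)}"
    have "D \<in> nc (chords a i)"
      by (rule nc_subset[OF F]) (use Fs in \<open>auto simp: D_def chords_def inner_def\<close>)
    moreover have "E \<in> nc (inner i b)"
      by (rule nc_subset[OF F]) (use Fs in \<open>auto simp: E_def chords_def inner_def\<close>)
    moreover have "F = D \<union> insert (i, b) E"
    proof -
      have "l \<le> i \<or> i \<le> k" if kl: "(k, l) \<in> F" for k l
      proof (rule ccontr)
        assume *: "\<not> (l \<le> i \<or> i \<le> k)"
        have "l \<le> b" using kl Fs by (auto simp: chords_def inner_def)
        moreover have "l \<noteq> b" using min kl * by auto
        ultimately have "crosses (k, l) (i, b)" using * by (simp add: crosses_Pair)
        then show False using nc_not_crosses[OF F kl ib] by simp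
      qed
      then show ?thesis using ib unfolding D_def E_def by fastforce
    qed
    ultimately show "F \<in> ?f ` ?A" using i
      by (intro image_eqI[of _ _ "(i, D, E)"]) auto
  qed
qed

lemma decomposition_card:
  assumes "a < i" "i < b - 1" "D \<in> nc (chords a i)" "E \<in> nc (inner i b)"
  shows "card (D \<union> insert (i, b) E) = card D + card E + 1"
    and "card (ending_at b (D \<union> insert (i, b) E)) = card (ending_at b E) + 1"
proof -
  have fin: "finite D" "finite E"
    using assms nc_finite finite_chords finite_inner by blast+
  have "c \<notin> D" if "c \<in> insert (i, b) E" for c
    using that assms(1,2) nc_chordsD[OF assms(3), of c] nc_innerD[OF assms(4), of c] by auto
  then have "D \<inter> insert (i, b) E = {}" by blast
  moreover have "(i, b) \<notin> E" using nc_innerD[OF assms(4), of "(i, b)"] by auto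
  ultimately show "card (D \<union> insert (i, b) E) = card D + card E + 1"
    using fin by (simp add: card_Un_disjoint)
  have "ending_at b (D \<union> insert (i, b) E) = insert (i, b) (ending_at b E)"
    using assms(1,2) by (auto simp: ending_at_def dest: nc_chordsD[OF assms(3)])
  then show "card (ending_at b (D \<union> insert (i, b) E)) = card (ending_at b E) + 1"
    using fin \<open>(i, b) \<notin> E\<close> by (simp add: ending_at_def)
qed

text \<open>With nothing ending at \<open>b\<close>, that vertex can be cut off; then
  \<open>(a, b - 1)\<close> is an ordinary admissible chord, hence \<open>chords\<close> and not
  \<open>inner\<close> on the right.\<close>

lemma nc_inner_ending_empty:
  "{D \<in> nc (inner a b). ending_at b D = {}} = (if a + 1 < b then nc (chords a (b - 1)) else {{}})"
proof (cases "a + 1 < b")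
  case True
  have "D \<in> nc (chords a (b - 1))" if "D \<in> nc (inner a b)" "ending_at b D = {}" for D
  proof (rule nc_subset[OF that(1)])
    show "D \<subseteq> chords a (b - 1)"
    proof
      fix c assume c: "c \<in> D"
      then have "snd c \<noteq> b" using that(2) unfolding ending_at_def by blast
      then show "c \<in> chords a (b - 1)"
        using nc_innerD[OF that(1) c] by (auto simp: chords_def split: prod.splits)
    qed
  qed simp
  moreover have "D \<in> nc (inner a b) \<and> ending_at b D = {}" if "D \<in> nc (chords a (b - 1))" for D
  proof
    show "D \<in> nc (inner a b)"
      by (rule nc_subset[OF that]) (use that True in \<open>auto simp: nc_def chords_def inner_def\<close>)
    show "ending_at b D = {}"
      using True by (auto simp: ending_at_def dest: nc_chordsD[OF that])
  qed
  ultimately show ?thesis using True by auto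
next
  case False
  then have "inner a b = {}" by (auto simp: inner_def chords_def)
  then show ?thesis using False by (auto simp: nc_def ending_at_def)
qed

section \<open>Maximal size, and counting by shortfall\<close>

text \<open>Both bounds go through one induction, as the decomposition splits a set of type
  \<open>inner\<close> into one of type \<open>chords\<close> and one of type \<open>inner\<close>.
  The values are the \<open>b - a - 2\<close> diagonals of a triangulated polygon, plus one for the
  base.\<close>

lemma card_nc_bound:
  "(a + 2 \<le> b \<longrightarrow> (\<forall>D \<in> nc (inner a b). card D + 2 \<le> b - a)) \<and>
   (a < b \<longrightarrow> (\<forall>D \<in> nc (chords a b). card D + 1 \<le> b - a))"
proof (induction "b - a" arbitrary: a b rule: less_induct)
  case less
  have inner: "card D + 2 \<le> b - a" if ab: "a + 2 \<le> b" and D: "D \<in> nc (inner a b)" for D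
  proof (cases "ending_at b D = {}")
    case True
    then have "D \<in> nc (chords a (b - 1))"
      using nc_inner_ending_empty[of a b] D ab by auto
    then have "card D + 1 \<le> (b - 1) - a" using less[of "b - 1" a] ab by simp
    then show ?thesis using ab by simp
  next
    case False
    then have "D \<in> {D \<in> nc (inner a b). ending_at b D \<noteq> {}}" using D by simp
    then obtain i D1 D2 where i: "a < i" "i < b - 1" and D12: "D1 \<in> nc (chords a i)"
      "D2 \<in> nc (inner i b)" and eq: "D = D1 \<union> insert (i, b) D2"
      unfolding bij_betw_imp_surj_on[OF first_chord_decomposition, symmetric] by auto
    have "card D1 + 1 \<le> i - a" using less[of i a] i D12 by simp
    moreover have "card D2 + 2 \<le> b - i" using less[of b i] i D12 by simp
    ultimately show ?thesis using decomposition_card[OF i D12] i eq by simp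
  qed
  have "card D + 1 \<le> b - a" if ab: "a < b" and D: "D \<in> nc (chords a b)" for D
  proof (cases "a + 2 \<le> b")
    case True
    have "D - {(a, b)} \<in> nc (inner a b)"
      by (rule nc_subset[OF D]) (use D in \<open>auto simp: nc_def inner_def\<close>)
    then have "card (D - {(a, b)}) + 2 \<le> b - a" using inner True by blast
    moreover have "card D \<le> card (D - {(a, b)}) + 1"
      by (auto simp: card_Diff_singleton_if)
    ultimately show ?thesis by simp
  next
    case False
    then have "D = {}" using D by (auto simp: nc_def chords_def)
    then show ?thesis using ab by simp
  qed
  with inner show ?case by blast
qed

lemma card_nc_chords: "a < b \<Longrightarrow> D \<in> nc (chords a b) \<Longrightarrow> card D + 1 \<le> b - a"
  and card_nc_inner: "a + 2 \<le> b \<Longrightarrow> D \<in> nc (inner a b) \<Longrightarrow> card D + 2 \<le> b - a"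
  using card_nc_bound by blast+

text \<open>Numbers of non-crossing sets of chords on the vertices \<open>0, \<dots>, L\<close> that fall short of the
  maximal size by \<open>\<delta>\<close>; the chord \<open>(0, L)\<close> is admitted in \<open>num_closed\<close> only. In \<open>num_fan\<close>, exactly
  \<open>p\<close> of the chords end at \<open>L\<close>.\<close>

definition num_closed :: "nat \<Rightarrow> nat \<Rightarrow> nat" where
  "num_closed \<delta> L = card {D \<in> nc (chords 0 L). card D + \<delta> + 1 = L}"

definition num_open :: "nat \<Rightarrow> nat \<Rightarrow> nat" where
  "num_open \<delta> L = card {D \<in> nc (inner 0 L). card D + \<delta> + 2 = L}"

definition num_fan :: "nat \<Rightarrow> nat \<Rightarrow> nat \<Rightarrow> nat" where
  "num_fan p \<delta> L = card {D \<in> nc (inner 0 L). card (ending_at L D) = p \<and> card D + \<delta> + 2 = L}"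

lemma num_fan_shift:
  assumes "i \<le> L"
  shows "card {D \<in> nc (inner i L). card (ending_at L D) = p \<and> card D + \<delta> + 2 = L - i}
       = num_fan p \<delta> (L - i)"
proof -
  let ?f = "\<lambda>(k, l). (k + i, l + i) :: nat \<times> nat"
  have "bij_betw ?f (inner 0 (L - i)) (inner i L)"
    by (rule bij_betw_byWitness[where f' = "\<lambda>(k, l). (k - i, l - i)"])
       (use assms in \<open>auto simp: inner_def chords_def\<close>)
  then have b: "bij_betw ((`) ?f) (nc (inner 0 (L - i))) (nc (inner i L))"
    by (rule bij_betw_nc) (auto simp: crosses_def)
  have inj: "inj_on ?f X" for X by (auto simp: inj_on_def)
  show ?thesis unfolding num_fan_def
  proof (rule bij_betw_card_filter[OF b, symmetric])
    fix D
    have "ending_at L (?f ` D) = ?f ` ending_at (L - i) D"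
      using assms by (force simp: ending_at_def)
    then show "(card (ending_at L (?f ` D)) = p \<and> card (?f ` D) + \<delta> + 2 = L - i) \<longleftrightarrow>
      (card (ending_at (L - i) D) = p \<and> card D + \<delta> + 2 = L - i)"
      by (simp add: card_image[OF inj])
  qed
qed

lemma num_fan_0: "num_fan 0 \<delta> L = (if L = 0 then 0 else num_closed \<delta> (L - 1))"
proof (cases "L < 2")
  case True
  then have "chords 0 (L - 1) = {}" by (auto simp: chords_def)
  then have "nc (chords 0 (L - 1)) = {{}}" by (auto simp: nc_def)
  then show ?thesis using True by (auto simp: num_fan_def num_closed_def)
next
  case False
  have "card (ending_at L D) = 0 \<longleftrightarrow> ending_at L D = {}" if "D \<in> nc (inner 0 L)" for D
    using nc_finite[OF finite_inner that] by (simp add: ending_at_def)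
  then have "{D \<in> nc (inner 0 L). card (ending_at L D) = 0 \<and> card D + \<delta> + 2 = L}
      = {D \<in> {D \<in> nc (inner 0 L). ending_at L D = {}}. card D + \<delta> + 2 = L}"
    by auto
  also have "\<dots> = {D \<in> nc (chords 0 (L - 1)). card D + \<delta> + 2 = L}"
    unfolding nc_inner_ending_empty using False by auto
  also have "\<dots> = {D \<in> nc (chords 0 (L - 1)). card D + \<delta> + 1 = L - 1}" using False by auto
  finally show ?thesis using False by (simp add: num_fan_def num_closed_def)
qed

text \<open>Since (i - 1 - \<epsilon>) + (L - i - 2 - (\<delta> - \<epsilon>)) + 1 = L - 2 -
  \<delta>, the shortfalls of the two parts add up to \<delta>, while the fan at \<open>L\<close>
  loses its first chord.\<close>

lemma num_fan_Suc:
  "num_fan (Suc p) \<delta> L = (\<Sum>i=0..L. \<Sum>\<epsilon>\<le>\<delta>. num_closed \<epsilon> i * num_fan p (\<delta> - \<epsilon>) (L - i))"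
proof -
  let ?f = "\<lambda>(i, D, E). D \<union> insert (i, L) E :: (nat \<times> nat) set"
  let ?A = "SIGMA i:{0<..<L - 1}. nc (chords 0 i) \<times> nc (inner i L)"
  let ?P = "\<lambda>(i, D, E). card (ending_at L E) = p \<and> card D + card E + \<delta> + 3 = L"
  define X where "X \<epsilon> i = {D \<in> nc (chords 0 i). card D + \<epsilon> + 1 = i}" for \<epsilon> i
  define Z where "Z \<epsilon> i = {E \<in> nc (inner i L). card (ending_at L E) = p \<and>
    card E + (\<delta> - \<epsilon>) + 2 = L - i}" for \<epsilon> i
  \<comment> \<open>The shortfall of \<open>D\<close> is \<open>i - 1 - card D\<close>; the maximal
    sizes keep it between 0 and \<delta>, and being determined by \<open>D\<close> it makes the
    union disjoint.\<close>
  have eq: "{t \<in> ?A. ?P t} = (SIGMA i:{0<..<L - 1}. \<Union>\<epsilon>\<le>\<delta>. X \<epsilon> i \<times> Z \<epsilon> i)"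
  proof (intro equalityI subsetI)
    fix t assume "t \<in> {t \<in> ?A. ?P t}"
    moreover obtain i D E where t: "t = (i, D, E)" by (cases t)
    ultimately have i: "0 < i" "i < L - 1" and D: "D \<in> nc (chords 0 i)"
      and E: "E \<in> nc (inner i L)" and P: "card (ending_at L E) = p" "card D + card E + \<delta> + 3 = L"
      by simp_all
    have b: "card D + 1 \<le> i" "card E + 2 \<le> L - i"
      using card_nc_chords[OF _ D] card_nc_inner[OF _ E] i by auto
    have "D \<in> X (i - 1 - card D) i" "E \<in> Z (i - 1 - card D) i" "i - 1 - card D \<le> \<delta>"
      using D E b P i by (simp_all add: X_def Z_def)
    then show "t \<in> (SIGMA i:{0<..<L - 1}. \<Union>\<epsilon>\<le>\<delta>. X \<epsilon> i \<times> Z \<epsilon> i)"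
      unfolding t using i by (intro SigmaI UN_I[of "i - 1 - card D"]) auto
  next
    fix t assume "t \<in> (SIGMA i:{0<..<L - 1}. \<Union>\<epsilon>\<le>\<delta>. X \<epsilon> i \<times> Z \<epsilon> i)"
    then obtain i \<epsilon> D E where t: "t = (i, D, E)" and i: "0 < i" "i < L - 1" and "\<epsilon> \<le> \<delta>"
      "D \<in> X \<epsilon> i" "E \<in> Z \<epsilon> i" by (elim SigmaE UN_E) auto
    then have "D \<in> nc (chords 0 i)" "E \<in> nc (inner i L)" "card (ending_at L E) = p"
      "card D + \<epsilon> + 1 = i" "card E + (\<delta> - \<epsilon>) + 2 = L - i"
      unfolding X_def Z_def by blast+
    moreover from this have "card D + card E + \<delta> + 3 = L" using \<open>\<epsilon> \<le> \<delta>\<close> by linarith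
    ultimately show "t \<in> {t \<in> ?A. ?P t}" using i unfolding t by simp
  qed
  have "num_fan (Suc p) \<delta> L = card {F \<in> {D \<in> nc (inner 0 L). ending_at L D \<noteq> {}}.
          card (ending_at L F) = Suc p \<and> card F + \<delta> + 2 = L}"
    unfolding num_fan_def by (rule arg_cong[where f = card]) auto
  also have "\<dots> = card {t \<in> ?A. ?P t}"
  proof (rule bij_betw_card_filter[OF first_chord_decomposition, symmetric])
    fix t assume "t \<in> ?A"
    then obtain i D E where t: "t = (i, D, E)" and i: "0 < i" "i < L - 1"
      and DE: "D \<in> nc (chords 0 i)" "E \<in> nc (inner i L)" by auto
    show "(card (ending_at L (?f t)) = Suc p \<and> card (?f t) + \<delta> + 2 = L) \<longleftrightarrow> ?P t"
      unfolding t prod.case decomposition_card[OF i DE] by auto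
  qed
  also have "\<dots> = (\<Sum>i\<in>{0<..<L - 1}. card (\<Union>\<epsilon>\<le>\<delta>. X \<epsilon> i \<times> Z \<epsilon> i))"
    unfolding eq by (rule card_SigmaI) (auto simp: X_def Z_def finite_nc)
  also have "\<dots> = (\<Sum>i\<in>{0<..<L - 1}. \<Sum>\<epsilon>\<le>\<delta>. card (X \<epsilon> i \<times> Z \<epsilon> i))"
    by (intro sum.cong refl card_UN_disjoint) (auto simp: X_def Z_def finite_nc)
  also have "\<dots> = (\<Sum>i\<in>{0<..<L - 1}. \<Sum>\<epsilon>\<le>\<delta>. num_closed \<epsilon> i * num_fan p (\<delta> - \<epsilon>) (L - i))"
  proof (intro sum.cong refl)
    fix i \<epsilon> assume "i \<in> {0<..<L - 1}"
    then have "i \<le> L" by auto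
    show "card (X \<epsilon> i \<times> Z \<epsilon> i) = num_closed \<epsilon> i * num_fan p (\<delta> - \<epsilon>) (L - i)"
      unfolding card_cartesian_product X_def Z_def num_closed_def num_fan_shift[OF \<open>i \<le> L\<close>] ..
  qed
  \<comment> \<open>The full range is what a product of power series produces; the added terms
    vanish because no set has a negative size.\<close>
  also have "\<dots> = (\<Sum>i=0..L. \<Sum>\<epsilon>\<le>\<delta>. num_closed \<epsilon> i * num_fan p (\<delta> - \<epsilon>) (L - i))"
  proof (rule sum.mono_neutral_left)
    show "\<forall>i\<in>{0..L} - {0<..<L - 1}. (\<Sum>\<epsilon>\<le>\<delta>. num_closed \<epsilon> i * num_fan p (\<delta> - \<epsilon>) (L - i)) = 0"
    proof
      fix i assume "i \<in> {0..L} - {0<..<L - 1}"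
      then have "i = 0 \<or> L - i < 2" by auto
      then show "(\<Sum>\<epsilon>\<le>\<delta>. num_closed \<epsilon> i * num_fan p (\<delta> - \<epsilon>) (L - i)) = 0"
        by (auto simp: num_closed_def num_fan_def)
    qed
  qed auto
  finally show ?thesis .
qed

text \<open>The cutoff \<open>K\<close> is left free so that a single range of \<open>p\<close>
  serves all lengths \<open>L - i\<close> in the recursion.\<close>

lemma num_open_eq_sum:
  assumes "L \<le> K"
  shows "num_open \<delta> L = (\<Sum>p<K. num_fan p \<delta> L)"
proof -
  have "{D \<in> nc (inner 0 L). card D + \<delta> + 2 = L}
      = (\<Union>p<K. {D \<in> nc (inner 0 L). card (ending_at L D) = p \<and> card D + \<delta> + 2 = L})"
  proof (intro equalityI subsetI)
    fix D assume D: "D \<in> {D \<in> nc (inner 0 L). card D + \<delta> + 2 = L}"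
    then have "card (ending_at L D) \<le> card D"
      using nc_finite[of "inner 0 L" D] by (auto simp: ending_at_def intro: card_mono)
    then show "D \<in> (\<Union>p<K. {D \<in> nc (inner 0 L). card (ending_at L D) = p \<and> card D + \<delta> + 2 = L})"
      using D assms by auto
  qed auto
  then show ?thesis unfolding num_open_def num_fan_def
    by (simp only:) (rule card_UN_disjoint, auto simp: finite_nc)
qed

lemma num_open_rec:
  assumes "L > 0"
  shows "num_open \<delta> L =
    num_closed \<delta> (L - 1) + (\<Sum>i=0..L. \<Sum>\<epsilon>\<le>\<delta>. num_closed \<epsilon> i * num_open (\<delta> - \<epsilon>) (L - i))"
proof -
  have "num_open \<delta> L = (\<Sum>p<Suc L. num_fan p \<delta> L)"
    by (rule num_open_eq_sum) simp
  also have "\<dots> = num_closed \<delta> (L - 1) + (\<Sum>p<L. num_fan (Suc p) \<delta> L)"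
    using assms by (subst sum.lessThan_Suc_shift) (simp add: num_fan_0)
  also have "(\<Sum>p<L. num_fan (Suc p) \<delta> L)
      = (\<Sum>i=0..L. \<Sum>\<epsilon>\<le>\<delta>. num_closed \<epsilon> i * (\<Sum>p<L. num_fan p (\<delta> - \<epsilon>) (L - i)))"
    unfolding num_fan_Suc sum_distrib_left
    by (subst sum.swap) (intro sum.cong refl sum.swap)
  also have "\<dots> = (\<Sum>i=0..L. \<Sum>\<epsilon>\<le>\<delta>. num_closed \<epsilon> i * num_open (\<delta> - \<epsilon>) (L - i))"
    by (intro sum.cong refl) (simp add: num_open_eq_sum[of _ L])
  finally show ?thesis .
qed

lemma insert_base_nc:
  assumes "L \<ge> 2" "D \<in> nc (inner 0 L)"
  shows "insert (0, L) D \<in> nc (chords 0 L)"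
proof -
  have "\<not> crosses (0, L) c \<and> \<not> crosses c (0, L)" if "c \<in> insert (0, L) D" for c
    using that nc_innerD[OF assms(2), of c] by (auto simp: crosses_def)
  then show ?thesis using assms by (auto simp: nc_def inner_def chords_def)
qed

lemma num_open_eq_card_with_base:
  assumes "L \<ge> 2"
  shows "card {D \<in> nc (chords 0 L). card D + \<delta> + 1 = L \<and> (0, L) \<in> D} = num_open \<delta> L"
proof -
  have ins: "bij_betw (insert (0, L)) (nc (inner 0 L)) {D \<in> nc (chords 0 L). (0, L) \<in> D}"
  proof (rule bij_betw_byWitness[where f' = "\<lambda>D. D - {(0, L)}"])
    show "insert (0, L) ` nc (inner 0 L) \<subseteq> {D \<in> nc (chords 0 L). (0, L) \<in> D}"
      using insert_base_nc[OF assms] by auto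
  qed (auto simp: nc_def inner_def)
  have "card (insert (0, L) D) = card D + 1" if "D \<in> nc (inner 0 L)" for D
    using nc_finite[OF finite_inner that] nc_innerD[OF that, of "(0, L)"]
    by (subst card_insert_disjoint) auto
  then have "num_open \<delta> L = card {D \<in> {D \<in> nc (chords 0 L). (0, L) \<in> D}. card D + \<delta> + 1 = L}"
    unfolding num_open_def by (intro bij_betw_card_filter[OF ins]) auto
  also have "\<dots> = card {D \<in> nc (chords 0 L). card D + \<delta> + 1 = L \<and> (0, L) \<in> D}"
    by (rule arg_cong[where f = card]) auto
  finally show ?thesis by simp
qed

text \<open>Measured in \<open>inner\<close>, where the maximum is smaller by one, a set without the
  base has a shortfall smaller by one. At shortfall 0 there is no such set: a maximal one contains
  the base.\<close>

lemma num_closed_eq_num_open: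
  assumes "L \<ge> 2"
  shows "num_closed 0 L = num_open 0 L"
    and "num_closed (Suc \<delta>) L = num_open (Suc \<delta>) L + num_open \<delta> L"
proof -
  let ?P = "\<lambda>\<delta> D. card D + \<delta> + 1 = L"
  note w = num_open_eq_card_with_base[OF assms]
  have wo: "{D \<in> nc (chords 0 L). ?P \<delta> D \<and> (0, L) \<notin> D} = {D \<in> nc (inner 0 L). ?P \<delta> D}" for \<delta>
    by (auto simp: nc_def inner_def)
  have split: "num_closed \<delta> L = num_open \<delta> L + card {D \<in> nc (inner 0 L). ?P \<delta> D}" for \<delta>
  proof -
    have "{D \<in> nc (chords 0 L). ?P \<delta> D} = {D \<in> nc (chords 0 L). ?P \<delta> D \<and> (0, L) \<in> D} \<union>
       {D \<in> nc (chords 0 L). ?P \<delta> D \<and> (0, L) \<notin> D}" by auto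
    then show ?thesis unfolding num_closed_def w[symmetric] wo[symmetric]
      by (simp only:) (rule card_Un_disjoint, auto simp: finite_nc)
  qed
  have e: "{D \<in> nc (inner 0 L). ?P 0 D} = {}"
    using card_nc_inner[of 0 L] assms by fastforce
  show "num_closed 0 L = num_open 0 L" using split[of 0] unfolding e by simp
  show "num_closed (Suc \<delta>) L = num_open (Suc \<delta>) L + num_open \<delta> L"
    using split[of "Suc \<delta>"] by (simp add: num_open_def)
qed

lemma num_closed_small: "num_closed \<delta> 0 = 0" "num_closed \<delta> (Suc 0) = (if \<delta> = 0 then 1 else 0)"
proof -
  have e: "nc (chords 0 (Suc 0)) = {{}}" by (auto simp: nc_def chords_def)
  have "num_closed \<delta> (Suc 0) = card {D :: (nat \<times> nat) set. D = {} \<and> \<delta> = 0}"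
    unfolding num_closed_def e by (intro arg_cong[where f = card] Collect_cong) auto
  then show "num_closed \<delta> (Suc 0) = (if \<delta> = 0 then 1 else 0)" by simp
qed (simp add: num_closed_def)

lemma num_open_small: "L < 2 \<Longrightarrow> num_open \<delta> L = 0"
  by (simp add: num_open_def)

section \<open>Generating functions\<close>

definition closed_fps :: "nat \<Rightarrow> real fps" where
  "closed_fps \<delta> = Abs_fps (\<lambda>L. real (num_closed \<delta> L))"

definition open_fps :: "nat \<Rightarrow> real fps" where
  "open_fps \<delta> = Abs_fps (\<lambda>L. real (num_open \<delta> L))"

definition fan_fps :: "nat \<Rightarrow> nat \<Rightarrow> real fps" where
  "fan_fps p \<delta> = Abs_fps (\<lambda>L. real (num_fan p \<delta> L))"

lemma fan_fps_0: "fan_fps 0 \<delta> = fps_X * closed_fps \<delta>"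
  by (rule fps_ext) (simp add: fan_fps_def closed_fps_def num_fan_0)

lemma fan_fps_Suc: "fan_fps (Suc p) \<delta> = (\<Sum>\<epsilon>\<le>\<delta>. closed_fps \<epsilon> * fan_fps p (\<delta> - \<epsilon>))"
proof (rule fps_ext)
  fix L
  show "fan_fps (Suc p) \<delta> $ L = (\<Sum>\<epsilon>\<le>\<delta>. closed_fps \<epsilon> * fan_fps p (\<delta> - \<epsilon>)) $ L"
    unfolding fps_sum_nth fps_mult_nth fan_fps_def closed_fps_def
    by (subst sum.swap) (simp add: num_fan_Suc)
qed

lemma open_fps_rec:
  "open_fps \<delta> = fps_X * closed_fps \<delta> + (\<Sum>\<epsilon>\<le>\<delta>. closed_fps \<epsilon> * open_fps (\<delta> - \<epsilon>))"
proof (rule fps_ext)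
  fix L
  show "open_fps \<delta> $ L = (fps_X * closed_fps \<delta> + (\<Sum>\<epsilon>\<le>\<delta>. closed_fps \<epsilon> * open_fps (\<delta> - \<epsilon>))) $ L"
  proof (cases "L = 0")
    case True
    then show ?thesis
      by (simp add: fps_sum_nth fps_mult_nth open_fps_def closed_fps_def num_open_small)
  next
    case False
    then show ?thesis unfolding fps_add_nth fps_sum_nth fps_mult_nth[of "closed_fps _" "open_fps _"]
      by (subst sum.swap) (simp add: num_open_rec open_fps_def closed_fps_def)
  qed
qed

lemma closed_fps_0: "closed_fps 0 = fps_X + open_fps 0"
proof (rule fps_ext)
  fix L
  consider "L = 0" | "L = Suc 0" | "L \<ge> 2" by linarith
  then show "closed_fps 0 $ L = (fps_X + open_fps 0) $ L"
    by cases (auto simp: closed_fps_def open_fps_def num_closed_small num_open_small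
      num_closed_eq_num_open)
qed

lemma closed_fps_Suc: "closed_fps (Suc \<delta>) = open_fps (Suc \<delta>) + open_fps \<delta>"
proof (rule fps_ext)
  fix L
  consider "L = 0" | "L = Suc 0" | "L \<ge> 2" by linarith
  then show "closed_fps (Suc \<delta>) $ L = (open_fps (Suc \<delta>) + open_fps \<delta>) $ L"
    by cases (auto simp: closed_fps_def open_fps_def num_closed_small num_open_small
      num_closed_eq_num_open)
qed

text \<open>These are the coefficients of t^0, t^1 and t^2 in the functional equation for Y.
  Eliminating \<open>open_fps\<close> takes substitution only, no division by 1 - Y_0.\<close>

lemma closed_fps_equations:
  shows "closed_fps 0 = fps_X + closed_fps 0 ^ 2"
    and "closed_fps 1 = 2 * closed_fps 0 * closed_fps 1 + fps_X * closed_fps 0"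
    and "closed_fps 2 = 2 * closed_fps 0 * closed_fps 2 + closed_fps 1 ^ 2 + fps_X * closed_fps 1"
proof -
  define y0 y1 y2 n0 n1 n2 where d: "y0 = closed_fps 0" "y1 = closed_fps 1" "y2 = closed_fps 2"
    "n0 = open_fps 0" "n1 = open_fps 1" "n2 = open_fps 2"
  have y: "y0 = fps_X + n0" "y1 = n1 + n0" "y2 = n2 + n1"
    using closed_fps_0 closed_fps_Suc[of 0] closed_fps_Suc[of 1] by (simp_all add: d numeral_2_eq_2)
  have n: "n0 = fps_X * y0 + y0 * n0" "n1 = fps_X * y1 + (y0 * n1 + y1 * n0)"
    "n2 = fps_X * y2 + (y0 * n2 + y1 * n1 + y2 * n0)"
    using open_fps_rec[of 0] open_fps_rec[of 1] open_fps_rec[of 2]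
    by (simp_all add: d numeral_2_eq_2)
  show e0: "closed_fps 0 = fps_X + closed_fps 0 ^ 2"
    unfolding d[symmetric] using n y by algebra
  show e1: "closed_fps 1 = 2 * closed_fps 0 * closed_fps 1 + fps_X * closed_fps 0"
    unfolding d[symmetric] using n y e0[unfolded d[symmetric]] by algebra
  show "closed_fps 2 = 2 * closed_fps 0 * closed_fps 2 + closed_fps 1 ^ 2 + fps_X * closed_fps 1"
    unfolding d[symmetric] using n y e0[unfolded d[symmetric]] e1[unfolded d[symmetric]] by algebra
qed

section \<open>Closed forms from the derivative of Y_0\<close>

text \<open>Triangulations of a polygon with \<open>L + 1\<close> sides, hence the Catalan number
  with index \<open>L - 1\<close>; a single edge (\<open>L = 1\<close>) counts as 1.\<close>

definition triang :: "nat \<Rightarrow> real" where "triang L = real (num_closed 0 L)"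

lemma triang_1: "triang 1 = 1"
  by (simp add: triang_def num_closed_small)

text \<open>The series 1 - 2 Y_0 plays the role of the square root of 1 - 4X. Its inverse is a
  derivative, so dividing by it leaves series with known coefficients.\<close>

lemma closed_fps_0_deriv:
  "fps_deriv (closed_fps 0) * (1 - 2 * closed_fps 0) = 1"
  "(1 - 2 * closed_fps 0)^2 = 1 - 4 * fps_X"
proof -
  have "fps_deriv (closed_fps 0) = fps_deriv (fps_X + closed_fps 0 ^ 2)"
    using closed_fps_equations(1) by simp
  then have "fps_deriv (closed_fps 0) = 1 + 2 * closed_fps 0 * fps_deriv (closed_fps 0)"
    by (simp add: power2_eq_square algebra_simps)
  then show "fps_deriv (closed_fps 0) * (1 - 2 * closed_fps 0) = 1" by algebra
  show "(1 - 2 * closed_fps 0)^2 = 1 - 4 * fps_X"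
    using closed_fps_equations(1) by algebra
qed

lemma closed_fps_0_nth: "closed_fps 0 $ L = triang L"
  by (simp add: closed_fps_def triang_def)

lemma numeral_mult_fps_nth: "(numeral k * f) $ L = numeral k * (f $ L :: real)"
  by (simp add: numeral_fps_const)

text \<open>Read off from the linear differential equation (1 - 4X) Y_0' = 1 - 2 Y_0; for
  \<open>L \<ge> 1\<close> its constant 1 does not contribute.\<close>

lemma triang_rec:
  assumes "L \<ge> 1"
  shows "real (Suc L) * triang (Suc L) = (4 * real L - 2) * triang L"
proof -
  have "(1 - 4 * fps_X) * fps_deriv (closed_fps 0) = 1 - 2 * closed_fps 0"
    using closed_fps_0_deriv by algebra
  then have "fps_deriv (closed_fps 0) - 4 * (fps_X * fps_deriv (closed_fps 0)) = 1 - 2 * closed_fps 0"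
    by (simp add: algebra_simps)
  from arg_cong[OF this, of "\<lambda>f. f $ L"] assms
  have "real (Suc L) * triang (Suc L) - 4 * (real L * triang L) = - 2 * triang L"
    by (simp add: numeral_mult_fps_nth closed_fps_0_nth)
  then show ?thesis by (simp add: algebra_simps)
qed

text \<open>The linear equation for \<open>y\<close> gives y = X c g, and 2 c g = g - 1 because g is
  the inverse of 1 - 2c; so 2y = X (g - 1) is linear in \<open>g\<close>.\<close>

lemma num_closed_1:
  assumes "L \<ge> 2"
  shows "real (num_closed 1 L) = (2 * real L - 3) * triang (L - 1)"
proof -
  define c g y where d: "c = closed_fps 0" "g = fps_deriv c" "y = closed_fps 1"
  have "g * (1 - 2 * c) = 1" "y = 2 * c * y + fps_X * c"
    using closed_fps_equations(2) closed_fps_0_deriv(1) by (simp_all add: d)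
  then have "2 * y = fps_X * (g - 1)" by algebra
  from arg_cong[OF this, of "\<lambda>f. f $ L"] assms triang_rec[of "L - 1"]
  have "2 * real (num_closed 1 L) = (4 * real L - 6) * triang (L - 1)"
    by (simp add: numeral_mult_fps_nth closed_fps_0_nth d closed_fps_def[of "Suc 0"] of_nat_diff)
  then show ?thesis by (simp add: algebra_simps)
qed

text \<open>Solving for \<open>z\<close> gives 4z = X^2 (g^3 - g). The cube need not be expanded:
  differentiating g (1 - 2c) = 1 yields g' = 2 g^3, whose coefficients are immediate.\<close>

lemma num_closed_2:
  assumes "L \<ge> 3"
  shows "real (num_closed 2 L) = (real L - 1) * (real L - 2) / 2 * triang (L - 1)"
proof -
  define c g y z where d: "c = closed_fps 0" "g = fps_deriv c" "y = closed_fps 1" "z = closed_fps 2"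
  have e: "g * (1 - 2 * c) = 1" "y = 2 * c * y + fps_X * c" "z = 2 * c * z + y ^ 2 + fps_X * y"
      "(1 - 2 * c)^2 = 1 - 4 * fps_X"
    using closed_fps_equations(2,3) closed_fps_0_deriv by (simp_all add: d)
  have y: "2 * y = fps_X * (g - 1)" using e by algebra
  have z: "4 * z = fps_X^2 * (g^3 - g)" using e y by algebra
  have "fps_deriv (g * (1 - 2 * c)) = 0" using e(1) by simp
  then have "fps_deriv g * (1 - 2 * c) = 2 * g * g" by (simp add: d algebra_simps)
  then have "fps_deriv g = 2 * g^3" using e(1) by algebra
  then have "8 * z = fps_X * (fps_X * (fps_deriv g - 2 * g))" using z by algebra
  moreover obtain k where L: "L = Suc (Suc k)"
    using assms by (intro that[of "L - 2"]) simp
  ultimately have "(8 * z) $ Suc (Suc k) = (fps_X * (fps_X * (fps_deriv g - 2 * g))) $ Suc (Suc k)"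
    by simp
  then have "8 * real (num_closed 2 L) = (real L - 1) * real L * triang L - 2 * (real L - 1) * triang (L - 1)"
    by (simp add: numeral_mult_fps_nth closed_fps_0_nth d closed_fps_def[of 2] L)
  moreover have "real L * triang L = (4 * real L - 6) * triang (L - 1)"
    using triang_rec[of "L - 1"] assms by (simp add: of_nat_diff)
  ultimately show ?thesis by algebra
qed

lemma num_open_1:
  assumes "L \<ge> 2"
  shows "real (num_open 1 L) = (2 * real L - 3) * triang (L - 1) - triang L"
  using num_closed_1[OF assms] num_closed_eq_num_open(1)[OF assms]
    num_closed_eq_num_open(2)[OF assms, of 0] by (simp add: triang_def)

lemma num_open_2:
  assumes "L \<ge> 3"
  shows "real (num_open 2 L) = (real L - 1) * (real L - 2) / 2 * triang (L - 1) - (2 * real L - 3) * triang (L - 1) + triang L"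
  using num_closed_2[OF assms] num_open_1[of L] num_closed_eq_num_open(2)[of L 1] assms
  by (simp add: numeral_2_eq_2)

text \<open>Without shortfall, a fan of \<open>p\<close> chords has the series X c^(p+1). Reducing
  powers by c^2 = c - X makes it linear in \<open>c\<close>, with corrections X and X^2 that the
  lower bounds on \<open>L\<close> avoid.\<close>

lemma num_fan_values:
  assumes "L \<ge> 2"
  shows "real (num_fan 1 0 (Suc L)) = triang L"
    and "real (num_fan 2 0 (Suc L)) = triang L - triang (L - 1)"
    and "L \<ge> 3 \<Longrightarrow> real (num_fan 3 0 (Suc L)) = triang L - 2 * triang (L - 1)"
    and "real (num_fan 1 1 (Suc L)) = (2 * real L - 4) * triang (L - 1)"
proof -
  define c y where d: "c = closed_fps 0" "y = closed_fps 1"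
  have e: "c = fps_X + c^2" "y = 2 * c * y + fps_X * c"
    using closed_fps_equations(1,2) by (simp_all add: d)
  have f: "fan_fps 1 0 = c * (fps_X * c)" "fan_fps 2 0 = c * fan_fps 1 0" "fan_fps 3 0 = c * fan_fps 2 0"
    "fan_fps 1 1 = c * (fps_X * y) + y * (fps_X * c)"
    using fan_fps_Suc[of 0 0] fan_fps_Suc[of 1 0] fan_fps_Suc[of 2 0] fan_fps_Suc[of 0 1]
    by (simp_all add: d fan_fps_0 numeral_2_eq_2 numeral_3_eq_3)
  have g: "fan_fps 1 0 = fps_X * (c - fps_X)" "fan_fps 2 0 = fps_X * (c - fps_X - fps_X * c)"
     "fan_fps 3 0 = fps_X * (c - fps_X - 2 * (fps_X * c) + fps_X * fps_X)"
     "fan_fps 1 1 = fps_X * (y - fps_X * c)"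
    using f e by algebra+
  have y: "y $ L = (2 * real L - 3) * triang (L - 1)"
    using num_closed_1[of L] assms by (simp add: d closed_fps_def)
  note simps = fan_fps_def numeral_mult_fps_nth closed_fps_0_nth d(1)
  show "real (num_fan 1 0 (Suc L)) = triang L"
    using arg_cong[OF g(1), of "\<lambda>f. f $ Suc L"] assms by (simp add: simps)
  show "real (num_fan 2 0 (Suc L)) = triang L - triang (L - 1)"
    using arg_cong[OF g(2), of "\<lambda>f. f $ Suc L"] assms by (simp add: simps)
  show "real (num_fan 3 0 (Suc L)) = triang L - 2 * triang (L - 1)" if "L \<ge> 3"
    using that arg_cong[OF g(3), of "\<lambda>f. f $ Suc L"] assms by (simp add: simps)
  show "real (num_fan 1 1 (Suc L)) = (2 * real L - 4) * triang (L - 1)"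
    using arg_cong[OF g(4), of "\<lambda>f. f $ Suc L"] assms y by (simp add: simps algebra_simps)
qed

section \<open>Symmetries of the polygon\<close>

definition rot :: "nat \<Rightarrow> nat \<Rightarrow> nat \<Rightarrow> nat" where
  "rot n r i = (i + r) mod n"

definition flip :: "nat \<Rightarrow> nat \<Rightarrow> nat \<Rightarrow> nat" where
  "flip n r i = (r + n - i) mod n"

definition act :: "(nat \<Rightarrow> nat) \<Rightarrow> nat \<times> nat \<Rightarrow> nat \<times> nat" where
  "act \<sigma> c = (min (\<sigma> (fst c)) (\<sigma> (snd c)), max (\<sigma> (fst c)) (\<sigma> (snd c)))"

abbreviation ends :: "nat \<times> nat \<Rightarrow> nat set" where
  "ends c \<equiv> {fst c, snd c}"

text \<open>Preservation of crossings is demanded instead of a formula for \<sigma>. This makes the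
  notion closed under composition, so that only the rotation by one and a single mirror image have
  to be examined by cases.\<close>

definition symmetry :: "nat \<Rightarrow> (nat \<Rightarrow> nat) \<Rightarrow> bool" where
  "symmetry n \<sigma> \<longleftrightarrow> inj_on \<sigma> {..<n} \<and> \<sigma> ` {..<n} \<subseteq> {..<n} \<and>
     act \<sigma> ` inner 0 (n - 1) \<subseteq> inner 0 (n - 1) \<and>
     (\<forall>c\<in>inner 0 (n - 1). \<forall>d\<in>inner 0 (n - 1). crosses (act \<sigma> c) (act \<sigma> d) \<longleftrightarrow> crosses c d)"

definition fixed_dissections :: "nat \<Rightarrow> nat \<Rightarrow> (nat \<Rightarrow> nat) \<Rightarrow> (nat \<times> nat) set set" where
  "fixed_dissections n k \<sigma> = {D \<in> nc (inner 0 (n - 1)). card D = k \<and> act \<sigma> ` D = D}"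

lemma mod_once: "a < 2 * n \<Longrightarrow> a mod n = (if a < n then a else a - n)" for a n :: nat
  by (simp add: le_mod_geq)

lemma rot_if: "i < n \<Longrightarrow> r < n \<Longrightarrow> rot n r i = (if i + r < n then i + r else i + r - n)"
  by (auto simp: rot_def mod_once)

lemma flip_if: "i < n \<Longrightarrow> r < n \<Longrightarrow> flip n r i = (if i \<le> r then r - i else r + n - i)"
  by (auto simp: flip_def mod_once)

lemma innerD: "c \<in> inner 0 (n - 1) \<Longrightarrow> fst c < n \<and> snd c < n \<and> fst c + 2 \<le> snd c"
  by (auto simp: inner_def chords_def)

lemma act_rot:
  assumes "fst c < snd c" "snd c < n" "r < n"
  shows "act (rot n r) c = (if snd c + r < n then (fst c + r, snd c + r)
    else if fst c + r < n then (snd c + r - n, fst c + r) else (fst c + r - n, snd c + r - n))"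
  using assms by (auto simp: act_def rot_if min_def max_def)

lemma act_flip:
  assumes "fst c < snd c" "snd c < n" "r < n"
  shows "act (flip n r) c = (if snd c \<le> r then (r - snd c, r - fst c)
    else if fst c \<le> r then (r - fst c, r + n - snd c) else (r + n - snd c, r + n - fst c))"
  using assms by (auto simp: act_def flip_if min_def max_def)

lemma ends_act: "ends (act \<sigma> c) = \<sigma> ` ends c"
  by (auto simp: act_def min_def max_def)

lemma act_comp: "act \<sigma> (act \<tau> c) = act (\<lambda>i. \<sigma> (\<tau> i)) c"
  by (auto simp: act_def min_def max_def)

lemma act_cong: "\<sigma> (fst c) = \<tau> (fst c) \<Longrightarrow> \<sigma> (snd c) = \<tau> (snd c) \<Longrightarrow> act \<sigma> c = act \<tau> c"
  by (simp add: act_def)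

lemma inj_on_ends: "inj_on ends (inner 0 m)"
  by (auto simp: inj_on_def inner_def chords_def doubleton_eq_iff)

lemma symmetry_cong:
  assumes "symmetry n \<sigma>" "\<And>i. i < n \<Longrightarrow> g i = \<sigma> i"
  shows "symmetry n g"
proof -
  have "act g c = act \<sigma> c" if "c \<in> inner 0 (n - 1)" for c
    using innerD[OF that] assms(2) by (intro act_cong) auto
  moreover have "inj_on g {..<n} = inj_on \<sigma> {..<n}" "g ` {..<n} = \<sigma> ` {..<n}"
    using assms(2) by (auto intro!: inj_on_cong image_cong)
  ultimately show ?thesis using assms(1) unfolding symmetry_def by auto
qed

lemma symmetry_compose:
  assumes "symmetry n \<sigma>" "symmetry n \<tau>"
  shows "symmetry n (\<lambda>i. \<sigma> (\<tau> i))"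
proof -
  have "inj_on (\<sigma> \<circ> \<tau>) {..<n}"
    using assms unfolding symmetry_def by (intro comp_inj_on) (auto intro: inj_on_subset)
  moreover have "act (\<lambda>i. \<sigma> (\<tau> i)) = (\<lambda>c. act \<sigma> (act \<tau> c))" by (simp add: act_comp fun_eq_iff)
  ultimately show ?thesis using assms unfolding symmetry_def o_def by (simp add: image_subset_iff)
qed

lemma symmetry_rot_1:
  assumes "n > 1"
  shows "symmetry n (rot n 1)"
proof -
  have act: "act (rot n 1) c =
      (if snd c + 1 < n then (fst c + 1, snd c + 1) else (0, fst c + 1))" if "c \<in> inner 0 (n - 1)" for c
    using innerD[OF that] by (subst act_rot) auto
  show ?thesis unfolding symmetry_def
  proof (intro conjI ballI)
    show "inj_on (rot n 1) {..<n}"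
      using assms by (auto simp: inj_on_def rot_if split: if_splits)
    show "rot n 1 ` {..<n} \<subseteq> {..<n}" using assms by (auto simp: rot_def)
    show "act (rot n 1) ` inner 0 (n - 1) \<subseteq> inner 0 (n - 1)"
      using act by (auto simp: inner_def chords_def)
    fix c d assume cd: "c \<in> inner 0 (n - 1)" "d \<in> inner 0 (n - 1)"
    show "crosses (act (rot n 1) c) (act (rot n 1) d) \<longleftrightarrow> crosses c d"
      using innerD[OF cd(1)] innerD[OF cd(2)] unfolding act[OF cd(1)] act[OF cd(2)]
      by (auto simp: crosses_def)
  qed
qed

lemma symmetry_rot:
  assumes "r < n"
  shows "symmetry n (rot n r)"
proof (cases "n > 1")
  case True
  show ?thesis
  proof (induction r)
    case 0
    have "act (\<lambda>i. i) c = c" if "c \<in> inner 0 (n - 1)" for c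
      using innerD[OF that] by (simp add: act_def prod_eq_iff)
    then have "symmetry n (\<lambda>i. i)" by (auto simp: symmetry_def)
    then show ?case by (rule symmetry_cong) (simp add: rot_def)
  next
    case (Suc r)
    from symmetry_compose[OF symmetry_rot_1[OF True] Suc]
    show ?case by (rule symmetry_cong) (simp add: rot_def mod_simps)
  qed
next
  case False
  then have "inner 0 (n - 1) = {}" by (auto simp: inner_def chords_def)
  then show ?thesis using assms by (auto simp: symmetry_def inj_on_def rot_if)
qed

text \<open>The map i \<mapsto> n - 1 - i reverses the order of the vertices without wrapping
  around; as r - i is congruent to (n - 1 - i) + (r + 1), every reflection is this one followed by a
  rotation.\<close>

lemma symmetry_flip:
  assumes "r < n"
  shows "symmetry n (flip n r)"
proof -
  have act: "act (\<lambda>i. n - 1 - i) c = (n - 1 - snd c, n - 1 - fst c)" if "c \<in> inner 0 (n - 1)" for c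
    using innerD[OF that] by (auto simp: act_def min_def max_def)
  have mirror: "symmetry n (\<lambda>i. n - 1 - i)"
    unfolding symmetry_def
  proof (intro conjI ballI)
    show "inj_on (\<lambda>i. n - 1 - i) {..<n}" by (auto simp: inj_on_def)
    show "act (\<lambda>i. n - 1 - i) ` inner 0 (n - 1) \<subseteq> inner 0 (n - 1)"
      using act by (auto simp: inner_def chords_def)
    fix c d assume cd: "c \<in> inner 0 (n - 1)" "d \<in> inner 0 (n - 1)"
    show "crosses (act (\<lambda>i. n - 1 - i) c) (act (\<lambda>i. n - 1 - i) d) \<longleftrightarrow> crosses c d"
      using innerD[OF cd(1)] innerD[OF cd(2)] unfolding act[OF cd(1)] act[OF cd(2)]
      by (auto simp: crosses_def)
  qed auto
  have "(r + 1) mod n < n" using assms by simp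
  from symmetry_compose[OF symmetry_rot[OF this] mirror]
  have "symmetry n (\<lambda>i. rot n ((r + 1) mod n) (n - 1 - i))" .
  then show ?thesis
  proof (rule symmetry_cong)
    fix i assume "i < n"
    then have eq: "n - 1 - i + (r + 1) = r + n - i" by simp
    show "flip n r i = rot n ((r + 1) mod n) (n - 1 - i)"
      unfolding flip_def rot_def mod_add_right_eq eq ..
  qed
qed

section \<open>Diagonals and dissections as sets of increasing pairs\<close>

text \<open>The side between \<open>n - 1\<close> and 0 is the pair \<open>(0, n - 1)\<close> that
  \<open>inner\<close> removes; all other sides join consecutive numbers and fail
  \<open>i + 2 \<le> j\<close>.\<close>

lemma diagonals_eq:
  assumes "n \<ge> 3"
  shows "diagonals n = ends ` inner 0 (n - 1)"
proof (intro equalityI subsetI)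
  fix x assume "x \<in> diagonals n"
  then obtain i j where x: "x = {i, j}" "i < n" "j < n" "i \<noteq> j" "j \<noteq> (i + 1) mod n" "i \<noteq> (j + 1) mod n"
    by (auto simp: diagonals_def)
  have m: "(i + 1) mod n = (if i + 1 < n then i + 1 else 0)" "(j + 1) mod n = (if j + 1 < n then j + 1 else 0)"
    using x(2,3) by (simp_all add: mod_once)
  have "(min i j, max i j) \<in> inner 0 (n - 1)"
    using x(2-) unfolding m inner_def chords_def by (cases "i \<le> j") (auto split: if_splits)
  moreover have "x = ends (min i j, max i j)" using x(1) by (auto simp: min_def max_def)
  ultimately show "x \<in> ends ` inner 0 (n - 1)" by blast
next
  fix x assume "x \<in> ends ` inner 0 (n - 1)"
  then obtain i j where x: "x = {i, j}" and ij: "(i, j) \<in> inner 0 (n - 1)" by auto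
  then have ij': "i + 2 \<le> j" "j < n" "i = 0 \<longrightarrow> j \<noteq> n - 1"
    using assms by (auto simp: inner_def chords_def)
  then have m: "(i + 1) mod n = i + 1" "(j + 1) mod n = (if j + 1 < n then j + 1 else 0)"
    by (simp_all add: mod_once)
  have "i < n \<and> j < n \<and> i \<noteq> j \<and> j \<noteq> (i + 1) mod n \<and> i \<noteq> (j + 1) mod n"
    unfolding m using ij' by auto
  then show "x \<in> diagonals n" unfolding diagonals_def x by blast
qed

lemma crossing_ends:
  assumes "fst c < snd c" "fst d < snd d"
  shows "crossing (ends c) (ends d) \<longleftrightarrow> crosses c d"
proof
  assume "crossing (ends c) (ends d)"
  then obtain a b a' b' where "a < b" "b < a'" "a' < b'" "{ends c, ends d} = {{a, a'}, {b, b'}}"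
    by (auto simp: crossing_def)
  then show "crosses c d" using assms unfolding crosses_def doubleton_eq_iff by auto
next
  assume "crosses c d"
  then consider "fst c < fst d" "fst d < snd c" "snd c < snd d"
    | "fst d < fst c" "fst c < snd d" "snd d < snd c" by (auto simp: crosses_def)
  then show "crossing (ends c) (ends d)"
  proof cases
    case 1
    then show ?thesis unfolding crossing_def by blast
  next
    case 2
    then show ?thesis unfolding crossing_def by blast
  qed
qed

lemma bij_betw_dissections:
  assumes "n \<ge> 3"
  shows "bij_betw ((`) ends) {D \<in> nc (inner 0 (n - 1)). card D = k} (dissections n k)"
proof (rule bij_betw_imageI)
  have sub: "D \<subseteq> inner 0 (n - 1)" if "D \<in> nc (inner 0 (n - 1))" for D
    using that by (auto simp: nc_def)
  show "inj_on ((`) ends) {D \<in> nc (inner 0 (n - 1)). card D = k}"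
    by (rule inj_on_subset[OF inj_on_image_Pow[OF inj_on_ends]]) (use sub in blast)
  show "(`) ends ` {D \<in> nc (inner 0 (n - 1)). card D = k} = dissections n k"
  proof (intro equalityI subsetI)
    fix E assume "E \<in> (`) ends ` {D \<in> nc (inner 0 (n - 1)). card D = k}"
    then obtain D where D: "D \<in> nc (inner 0 (n - 1))" "card D = k" and E: "E = ends ` D" by auto
    have "card E = k" using card_image[OF inj_on_subset[OF inj_on_ends sub[OF D(1)]]] D E by simp
    moreover have "E \<subseteq> diagonals n" using sub[OF D(1)] E diagonals_eq[OF assms] by auto
    moreover have "finite E" using nc_finite[OF finite_inner D(1)] E by auto
    moreover have "\<not> crossing (ends c) (ends d)" if "c \<in> D" "d \<in> D" for c d
      using nc_not_crosses[OF D(1) that] crossing_ends[of c d] that nc_innerD[OF D(1), of c]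
        nc_innerD[OF D(1), of d] by auto
    ultimately show "E \<in> dissections n k" unfolding dissections_def pairwise_def E by auto
  next
    fix E assume E: "E \<in> dissections n k"
    then have "E \<subseteq> ends ` inner 0 (n - 1)" using diagonals_eq[OF assms] by (auto simp: dissections_def)
    then obtain D where D: "D \<subseteq> inner 0 (n - 1)" "E = ends ` D" by (auto simp: subset_image_iff)
    have "card D = k" using card_image[OF inj_on_subset[OF inj_on_ends D(1)]] D(2) E
      by (simp add: dissections_def)
    moreover have "\<not> crosses c d" if cd: "c \<in> D" "d \<in> D" for c d
    proof
      assume x: "crosses c d"
      have c: "fst c < snd c" "fst d < snd d"
        using innerD[of c n] innerD[of d n] cd D(1) by auto
      then have "crossing (ends c) (ends d)" using x crossing_ends by blast
      \<comment> \<open>Distinctness matters since \<open>pairwise\<close> constrains distinct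
        members only.\<close>
      moreover have "ends c \<noteq> ends d" using x c unfolding crosses_def doubleton_eq_iff by auto
      moreover have "pairwise (\<lambda>d e. \<not> crossing d e) E" using E by (simp add: dissections_def)
      moreover have "ends c \<in> E" "ends d \<in> E" using cd D(2) by simp_all
      ultimately show False by (metis pairwiseD)
    qed
    ultimately have "D \<in> {D \<in> nc (inner 0 (n - 1)). card D = k}" using D(1) by (simp add: nc_def)
    then show "E \<in> (`) ends ` {D \<in> nc (inner 0 (n - 1)). card D = k}" using D(2) by blast
  qed
qed

lemma bij_betw_act:
  assumes "symmetry n \<sigma>"
  shows "bij_betw (act \<sigma>) (inner 0 (n - 1)) (inner 0 (n - 1))"
proof -
  have inj: "inj_on \<sigma> {..<n}" using assms by (simp add: symmetry_def)
  have "inj_on (act \<sigma>) (inner 0 (n - 1))"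
  proof (rule inj_onI)
    fix c d assume cd: "c \<in> inner 0 (n - 1)" "d \<in> inner 0 (n - 1)" "act \<sigma> c = act \<sigma> d"
    then have "\<sigma> ` ends c = \<sigma> ` ends d" unfolding ends_act[symmetric] by simp
    then have "ends c = ends d"
      using inj_on_image_eq_iff[OF inj, of "ends c" "ends d"] innerD[OF cd(1)] innerD[OF cd(2)] by simp
    then show "c = d" using inj_onD[OF inj_on_ends _ cd(1,2)] by blast
  qed
  moreover from this have "act \<sigma> ` inner 0 (n - 1) = inner 0 (n - 1)"
    using assms by (intro endo_inj_surj) (auto simp: symmetry_def)
  ultimately show ?thesis by (simp add: bij_betw_def)
qed

lemma bij_betw_act_nc:
  assumes "symmetry n \<sigma>"
  shows "bij_betw ((`) (act \<sigma>)) (nc (inner 0 (n - 1))) (nc (inner 0 (n - 1)))"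
  by (rule bij_betw_nc[OF bij_betw_act[OF assms]]) (use assms in \<open>auto simp: symmetry_def\<close>)

lemma card_act_image:
  assumes "symmetry n \<sigma>" "D \<in> nc (inner 0 (n - 1))"
  shows "card (act \<sigma> ` D) = card D"
proof (rule card_image)
  have "D \<subseteq> inner 0 (n - 1)" using assms(2) by (auto simp: nc_def)
  then show "inj_on (act \<sigma>) D"
    using bij_betw_act[OF assms(1)] by (auto simp: bij_betw_def intro: inj_on_subset)
qed

lemma ends_image_act: "(`) \<sigma> ` (ends ` D) = ends ` (act \<sigma> ` D)"
  by (simp only: image_image ends_act)

lemma symmetry_dissections:
  assumes "n \<ge> 3" "symmetry n \<sigma>" "E \<in> dissections n k"
  shows "(`) \<sigma> ` E \<in> dissections n k"
proof -
  obtain D where D: "D \<in> nc (inner 0 (n - 1))" "card D = k" "E = ends ` D"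
    using assms(3) unfolding bij_betw_imp_surj_on[OF bij_betw_dissections[OF assms(1)], symmetric] by auto
  have "act \<sigma> ` D \<in> nc (inner 0 (n - 1))"
    using bij_betw_act_nc[OF assms(2)] D(1) by (auto simp: bij_betw_def)
  then show ?thesis
    unfolding bij_betw_imp_surj_on[OF bij_betw_dissections[OF assms(1)], symmetric] D(3) ends_image_act
    using card_act_image[OF assms(2) D(1)] D(2) by blast
qed

text \<open>Group elements are functions restricted to the vertices, while the counting works with
  total maps \<sigma>; agreement on the vertices is enough.\<close>

lemma card_invariants:
  assumes "n \<ge> 3" "symmetry n \<sigma>" "\<And>i. i < n \<Longrightarrow> g i = \<sigma> i"
  shows "card (invariants (dissections n k) (dissection_action n k) g) = card (fixed_dissections n k \<sigma>)"
proof -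
  have "card (fixed_dissections n k \<sigma>) = card {D \<in> {D \<in> nc (inner 0 (n - 1)). card D = k}. act \<sigma> ` D = D}"
    unfolding fixed_dissections_def by (rule arg_cong[where f = card]) auto
  also have "\<dots> = card {E \<in> dissections n k. (`) g ` E = E}"
  proof (rule bij_betw_card_filter[OF bij_betw_dissections[OF assms(1)]])
    fix D assume "D \<in> {D \<in> nc (inner 0 (n - 1)). card D = k}"
    then have D: "D \<in> nc (inner 0 (n - 1))" by simp
    have s: "D \<subseteq> inner 0 (n - 1)" using D by (auto simp: nc_def)
    have "act g ` D = act \<sigma> ` D"
      using s innerD[of _ n] assms(3) by (intro image_cong refl act_cong) auto
    then have "(`) g ` (ends ` D) = ends ` D \<longleftrightarrow> ends ` (act \<sigma> ` D) = ends ` D"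
      unfolding ends_image_act by simp
    also have "\<dots> \<longleftrightarrow> act \<sigma> ` D = D"
    proof (rule inj_on_image_eq_iff[OF inj_on_ends[of "n - 1"] _ s])
      show "act \<sigma> ` D \<subseteq> inner 0 (n - 1)" using s assms(2) unfolding symmetry_def by blast
    qed
    finally show "(`) g ` (ends ` D) = ends ` D \<longleftrightarrow> act \<sigma> ` D = D" .
  qed
  also have "{E \<in> dissections n k. (`) g ` E = E} = invariants (dissections n k) (dissection_action n k) g"
    by (auto simp: invariants_def dissection_action_def)
  finally show ?thesis by simp
qed

lemma finite_dissections:
  assumes "n \<ge> 3"
  shows "finite (dissections n k)"
  using bij_betw_finite[OF bij_betw_dissections[OF assms]] finite_nc[OF finite_inner] by simp

section \<open>The group actions and Burnside's lemma\<close>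

lemma group_action_dissections:
  assumes n: "n \<ge> 3" and sub: "subgroup \<Gamma> (BijGroup {..<n})"
    and sym: "\<And>g. g \<in> \<Gamma> \<Longrightarrow> symmetry n g"
  shows "group_action (BijGroup {..<n} \<lparr>carrier := \<Gamma>\<rparr>) (dissections n k) (dissection_action n k)"
    (is "group_action ?G ?E ?\<phi>")
proof -
  have G: "group ?G" using subgroup.subgroup_is_group[OF sub group_BijGroup] .
  have Bij: "?\<phi> g \<in> Bij ?E" if g: "g \<in> \<Gamma>" for g
  proof -
    have inj_g: "inj_on g {..<n}" using sym[OF g] by (simp add: symmetry_def)
    have P: "E \<subseteq> Pow {..<n}" if "E \<in> ?E" for E
      using that by (auto simp: dissections_def diagonals_def)
    have "inj_on (\<lambda>E. (`) g ` E) ?E"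
      by (rule inj_on_subset[OF inj_on_image_Pow[OF inj_on_image_Pow[OF inj_g]]]) (use P in blast)
    moreover from this have "(\<lambda>E. (`) g ` E) ` ?E = ?E"
      using symmetry_dissections[OF n sym[OF g]] finite_dissections[OF n]
      by (intro endo_inj_surj) auto
    ultimately show ?thesis unfolding Bij_def dissection_action_def bij_betw_def
      by (auto simp: inj_on_def)
  qed
  have "?\<phi> \<in> hom ?G (BijGroup ?E)"
  proof (rule homI)
    fix g assume "g \<in> carrier ?G"
    then show "?\<phi> g \<in> carrier (BijGroup ?E)" using Bij by (simp add: BijGroup_def)
  next
    fix g h assume "g \<in> carrier ?G" "h \<in> carrier ?G"
    then have g: "g \<in> \<Gamma>" and h: "h \<in> \<Gamma>" by auto
    have gh: "g \<in> Bij {..<n}" "h \<in> Bij {..<n}"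
      using subgroup.subset[OF sub] g h by (auto simp: BijGroup_def)
    have "(`) (compose {..<n} g h) ` E = (`) g ` (`) h ` E" if "E \<in> ?E" for E
    proof -
      have "compose {..<n} g h ` d = g ` h ` d" if "d \<in> E" for d
      proof -
        have "d \<subseteq> {..<n}" using that \<open>E \<in> ?E\<close> by (auto simp: dissections_def diagonals_def)
        then show ?thesis by (force simp: compose_def image_image)
      qed
      then show ?thesis by (simp add: image_image)
    qed
    moreover have "(`) h ` E \<in> ?E" if "E \<in> ?E" for E
      using symmetry_dissections[OF n sym[OF h] that] .
    ultimately have "?\<phi> (compose {..<n} g h) = compose ?E (?\<phi> g) (?\<phi> h)"
      by (auto simp: dissection_action_def compose_def fun_eq_iff)
    then show "?\<phi> (g \<otimes>\<^bsub>?G\<^esub> h) = ?\<phi> g \<otimes>\<^bsub>BijGroup ?E\<^esub> ?\<phi> h"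
      using Bij[OF g] Bij[OF h] gh by (simp add: BijGroup_def)
  qed
  then show ?thesis
    using G group_BijGroup by (simp add: group_action_def group_hom_def group_hom_axioms_def)
qed

lemma rotation_eq: "i < n \<Longrightarrow> rotation n r i = rot n r i"
  and reflection_eq: "i < n \<Longrightarrow> reflection n r i = flip n r i"
  by (simp_all add: rotation_def rot_def reflection_def flip_def)

lemma Bij_symmetry:
  assumes "symmetry n \<sigma>" "\<sigma> \<in> extensional {..<n}"
  shows "\<sigma> \<in> Bij {..<n}"
  using assms endo_inj_surj[of "{..<n}" \<sigma>] by (auto simp: Bij_def symmetry_def bij_betw_def)

lemma rotations_reflections_compose:
  assumes "r < n" "s < n"
  shows "compose {..<n} (rotation n r) (rotation n s) = rotation n ((r + s) mod n)"
    and "compose {..<n} (rotation n r) (reflection n s) = reflection n ((r + s) mod n)"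
    and "compose {..<n} (reflection n r) (rotation n s) = reflection n ((r + n - s) mod n)"
    and "compose {..<n} (reflection n r) (reflection n s) = rotation n ((r + n - s) mod n)"
  using assms
  by (auto simp: compose_def rotation_def reflection_def fun_eq_iff mod_once split: if_splits)

lemma subgroup_rotations:
  assumes "n > 0"
  shows "subgroup {rotation n r | r. r < n} (BijGroup {..<n})"
    and "subgroup ({rotation n r | r. r < n} \<union> {reflection n r | r. r < n}) (BijGroup {..<n})"
proof -
  interpret group "BijGroup {..<n}" by (rule group_BijGroup)
  have B: "rotation n r \<in> Bij {..<n}" "reflection n r \<in> Bij {..<n}" if "r < n" for r
  proof -
    show "rotation n r \<in> Bij {..<n}"
      using symmetry_cong[OF symmetry_rot[OF that] rotation_eq]
      by (rule Bij_symmetry) (simp_all add: rotation_def extensional_def)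
    show "reflection n r \<in> Bij {..<n}"
      using symmetry_cong[OF symmetry_flip[OF that] reflection_eq]
      by (rule Bij_symmetry) (simp_all add: reflection_def extensional_def)
  qed
  have m: "f \<otimes>\<^bsub>BijGroup {..<n}\<^esub> g = compose {..<n} f g" if "f \<in> Bij {..<n}" "g \<in> Bij {..<n}" for f g
    using that by (simp add: BijGroup_def)
  have one: "\<one>\<^bsub>BijGroup {..<n}\<^esub> = rotation n 0"
    by (auto simp: BijGroup_def rotation_def fun_eq_iff)
  have c: "carrier (BijGroup {..<n}) = Bij {..<n}" by (simp add: BijGroup_def)
  have inv_rot: "inv\<^bsub>BijGroup {..<n}\<^esub> (rotation n r) = rotation n ((n - r) mod n)" if "r < n" for r
  proof (rule inv_equality)
    have "((n - r) mod n + r) mod n = 0" using that by (simp add: mod_simps)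
    then show "rotation n ((n - r) mod n) \<otimes>\<^bsub>BijGroup {..<n}\<^esub> rotation n r = \<one>\<^bsub>BijGroup {..<n}\<^esub>"
      using that assms by (simp add: m B one rotations_reflections_compose)
  qed (use that assms in \<open>auto simp: c B\<close>)
  have inv_refl: "inv\<^bsub>BijGroup {..<n}\<^esub> (reflection n r) = reflection n r" if "r < n" for r
    by (rule inv_equality) (use that assms in \<open>auto simp: m c B one rotations_reflections_compose\<close>)
  show "subgroup {rotation n r | r. r < n} (BijGroup {..<n})"
  proof
    show "\<one>\<^bsub>BijGroup {..<n}\<^esub> \<in> {rotation n r | r. r < n}" using assms one by auto
  qed (use assms in \<open>auto simp: c B m inv_rot rotations_reflections_compose\<close>)
  show "subgroup ({rotation n r | r. r < n} \<union> {reflection n r | r. r < n}) (BijGroup {..<n})"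
  proof
    show "\<one>\<^bsub>BijGroup {..<n}\<^esub> \<in> {rotation n r | r. r < n} \<union> {reflection n r | r. r < n}"
      using assms one by auto
  qed (use assms in \<open>auto simp: c B m inv_rot inv_refl rotations_reflections_compose\<close>)
qed

lemma inj_on_rotation: "inj_on (rotation n) {..<n}"
  by (rule inj_onI) (auto simp: rotation_def fun_eq_iff dest!: spec[of _ 0])

lemma inj_on_reflection: "inj_on (reflection n) {..<n}"
  by (rule inj_onI) (auto simp: reflection_def fun_eq_iff dest!: spec[of _ 0])

text \<open>The vertices 0 and 1 go to r and r + 1, respectively to s and s - 1; equality would
  force 2 to be 0 modulo \<open>n\<close>. Hence the dihedral group has order 2n.\<close>

lemma rotation_neq_reflection:
  assumes "n \<ge> 3" "r < n" "s < n"
  shows "rotation n r \<noteq> reflection n s"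
proof
  assume "rotation n r = reflection n s"
  then have "rotation n r 0 = reflection n s 0" "rotation n r 1 = reflection n s 1" by auto
  then show False using assms by (auto simp: rotation_def reflection_def mod_once split: if_splits)
qed

lemma burnside_rotations:
  assumes "n \<ge> 3"
  shows "n * card (orbits (rotation_group n) (dissections n k) (dissection_action n k))
    = (\<Sum>r<n. card (fixed_dissections n k (rot n r)))"
proof -
  let ?R = "{rotation n r | r. r < n}"
  have R: "?R = rotation n ` {..<n}" by auto
  interpret group_action "rotation_group n" "dissections n k" "dissection_action n k"
    unfolding rotation_group_def
    by (rule group_action_dissections)
       (use assms subgroup_rotations[of n] symmetry_cong[OF symmetry_rot rotation_eq] in auto)
  have car: "carrier (rotation_group n) = ?R" by (simp add: rotation_group_def)
  have "card (orbits (rotation_group n) (dissections n k) (dissection_action n k)) * order (rotation_group n)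
      = (\<Sum>g\<in>?R. card (invariants (dissections n k) (dissection_action n k) g))"
    using burnside finite_dissections[OF assms] by (simp add: car R)
  moreover have "order (rotation_group n) = n"
    by (simp add: order_def car R card_image[OF inj_on_rotation])
  moreover have "(\<Sum>g\<in>?R. card (invariants (dissections n k) (dissection_action n k) g))
      = (\<Sum>r<n. card (fixed_dissections n k (rot n r)))"
    unfolding R sum.reindex[OF inj_on_rotation] o_def
    by (intro sum.cong refl card_invariants)
       (use assms symmetry_rot rotation_eq in auto)
  ultimately show ?thesis by (simp add: mult.commute)
qed

lemma burnside_dihedral:
  assumes "n \<ge> 3"
  shows "2 * n * card (orbits (dihedral_group n) (dissections n k) (dissection_action n k))
    = (\<Sum>r<n. card (fixed_dissections n k (rot n r))) + (\<Sum>r<n. card (fixed_dissections n k (flip n r)))"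
proof -
  let ?R = "{rotation n r | r. r < n} \<union> {reflection n r | r. r < n}"
  have R: "?R = rotation n ` {..<n} \<union> reflection n ` {..<n}" by auto
  have dis: "rotation n ` {..<n} \<inter> reflection n ` {..<n} = {}"
    using rotation_neq_reflection[OF assms] by auto
  interpret group_action "dihedral_group n" "dissections n k" "dissection_action n k"
    unfolding dihedral_group_def
    by (rule group_action_dissections)
       (use assms subgroup_rotations[of n] symmetry_cong[OF symmetry_rot rotation_eq]
          symmetry_cong[OF symmetry_flip reflection_eq] in auto)
  have car: "carrier (dihedral_group n) = ?R" by (simp add: dihedral_group_def)
  have "card (orbits (dihedral_group n) (dissections n k) (dissection_action n k)) * order (dihedral_group n)
      = (\<Sum>g\<in>?R. card (invariants (dissections n k) (dissection_action n k) g))"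
    using burnside finite_dissections[OF assms] by (simp add: car R)
  moreover have "order (dihedral_group n) = 2 * n"
    by (simp add: order_def car R card_Un_disjoint dis card_image inj_on_rotation inj_on_reflection)
  moreover have "(\<Sum>g\<in>?R. card (invariants (dissections n k) (dissection_action n k) g))
      = (\<Sum>r<n. card (invariants (dissections n k) (dissection_action n k) (rotation n r))) +
        (\<Sum>r<n. card (invariants (dissections n k) (dissection_action n k) (reflection n r)))"
    unfolding R by (simp add: sum.union_disjoint dis sum.reindex inj_on_rotation inj_on_reflection)
  moreover have "card (invariants (dissections n k) (dissection_action n k) (rotation n r))
      = card (fixed_dissections n k (rot n r))" if "r < n" for r
    using card_invariants[OF assms symmetry_rot[OF that] rotation_eq] by blast
  moreover have "card (invariants (dissections n k) (dissection_action n k) (reflection n r))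
      = card (fixed_dissections n k (flip n r))" if "r < n" for r
    using card_invariants[OF assms symmetry_flip[OF that] reflection_eq] by blast
  ultimately show ?thesis by (simp add: mult.commute)
qed

text \<open>The map \<open>act \<tau>\<close> carries the dissections fixed by \<sigma> to those
  fixed by its conjugate. \<open>P\<close> and \<open>Q\<close> transport a side condition, such as
  containing a prescribed chord.\<close>

lemma card_fixed_conj:
  assumes "symmetry n \<tau>" "symmetry n \<sigma>" "\<And>i. i < n \<Longrightarrow> \<sigma>' (\<tau> i) = \<tau> (\<sigma> i)"
    and "\<And>D. D \<in> nc (inner 0 (n - 1)) \<Longrightarrow> Q (act \<tau> ` D) \<longleftrightarrow> P D"
  shows "card {D \<in> fixed_dissections n k \<sigma>. P D} = card {D \<in> fixed_dissections n k \<sigma>'. Q D}"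
proof -
  have "card {D \<in> nc (inner 0 (n - 1)). card D = k \<and> act \<sigma> ` D = D \<and> P D} =
        card {D \<in> nc (inner 0 (n - 1)). card D = k \<and> act \<sigma>' ` D = D \<and> Q D}"
  proof (rule bij_betw_card_filter[OF bij_betw_act_nc[OF assms(1)]])
    fix D assume D: "D \<in> nc (inner 0 (n - 1))"
    have s: "D \<subseteq> inner 0 (n - 1)" using D by (simp add: nc_def)
    have "act \<sigma>' (act \<tau> c) = act \<tau> (act \<sigma> c)" if "c \<in> D" for c
      unfolding act_comp by (rule act_cong) (use assms(3) innerD[of c n] that s in auto)
    then have "act \<sigma>' ` (act \<tau> ` D) = act \<tau> ` (act \<sigma> ` D)" by (simp add: image_image)
    then have "act \<sigma>' ` (act \<tau> ` D) = act \<tau> ` D \<longleftrightarrow> act \<tau> ` (act \<sigma> ` D) = act \<tau> ` D" by simp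
    also have "\<dots> \<longleftrightarrow> act \<sigma> ` D = D"
    proof (rule inj_on_image_eq_iff[OF bij_betw_imp_inj_on[OF bij_betw_act[OF assms(1)]] _ s])
      show "act \<sigma> ` D \<subseteq> inner 0 (n - 1)" using s assms(2) unfolding symmetry_def by blast
    qed
    finally show "(card (act \<tau> ` D) = k \<and> act \<sigma>' ` act \<tau> ` D = act \<tau> ` D \<and> Q (act \<tau> ` D)) \<longleftrightarrow>
        (card D = k \<and> act \<sigma> ` D = D \<and> P D)"
      using card_act_image[OF assms(1) D] assms(4)[OF D] by simp
  qed
  then show ?thesis by (simp add: fixed_dissections_def conj_assoc)
qed

section \<open>Dissections fixed by a rotation\<close>

lemma rot_rot: "rot n r (rot n s i) = rot n (r + s) i"
  by (simp add: rot_def mod_simps add_ac)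

lemma rot_mod: "rot n (r mod n) = rot n r"
  by (simp add: rot_def mod_simps fun_eq_iff)

lemma act_rot_rot: "act (rot n r) (act (rot n s) c) = act (rot n (r + s)) c"
  by (simp add: act_comp rot_rot)

lemma act_rot_0:
  assumes "c \<in> inner 0 (n - 1)"
  shows "act (rot n 0) c = c" "act (rot n n) c = c"
  using innerD[OF assms] by (simp_all add: act_def rot_def prod_eq_iff)

lemma act_rot_image_0: "D \<in> nc (inner 0 (n - 1)) \<Longrightarrow> act (rot n 0) ` D = D"
  using act_rot_0(1)[of _ n] by (force simp: nc_def subset_iff)

lemma rot_invariant_mult:
  assumes "D \<in> nc (inner 0 (n - 1))" "act (rot n r) ` D = D"
  shows "act (rot n (t * r)) ` D = D"
proof (induction t)
  case 0
  show ?case using act_rot_image_0[OF assms(1)] by simp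
next
  case (Suc t)
  have "act (rot n (Suc t * r)) ` D = act (rot n r) ` (act (rot n (t * r)) ` D)"
    unfolding image_image act_rot_rot by simp
  then show ?case using Suc assms(2) by simp
qed

text \<open>By Bezout some multiple of \<open>r\<close> is congruent to the gcd modulo
  \<open>n\<close>, so both rotations generate the same group.\<close>

lemma rot_invariant_gcd:
  assumes D: "D \<in> nc (inner 0 (n - 1))" and "r > 0"
  shows "act (rot n r) ` D = D \<longleftrightarrow> act (rot n (gcd r n)) ` D = D"
proof
  assume inv: "act (rot n r) ` D = D"
  obtain x y where "r * x = n * y + gcd r n"
    using bezout_nat[of r n] assms(2) by auto
  then have "rot n (x * r) = rot n (gcd r n)"
    using rot_mod[of n "r * x"] rot_mod[of n "gcd r n"] by (simp add: mult.commute)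
  then show "act (rot n (gcd r n)) ` D = D"
    using rot_invariant_mult[OF D inv, of x] by simp
next
  assume "act (rot n (gcd r n)) ` D = D"
  from rot_invariant_mult[OF D this, of "r div gcd r n"] show "act (rot n r) ` D = D"
    by simp
qed

text \<open>Inequalities around a cycle are equalities. In the application it is therefore enough
  that the rotation injects each block into the next one.\<close>

lemma card_eq_of_cyclic_le:
  fixes f :: "nat \<Rightarrow> nat"
  assumes "\<And>t. Suc t < d \<Longrightarrow> f t \<le> f (Suc t)" "f (d - 1) \<le> f 0"
  shows "(\<Sum>t<d. f t) = d * f 0"
proof -
  have up: "f 0 \<le> f t" if "t < d" for t
    using that by (induction t) (use assms(1) in \<open>force intro: le_trans\<close>)+
  have down: "f (d - 1 - t) \<le> f 0" if "t < d" for t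
    using that
  proof (induction t)
    case (Suc t)
    then have "f (d - 1 - Suc t) \<le> f (Suc (d - 1 - Suc t))" by (intro assms(1)) simp
    also have "Suc (d - 1 - Suc t) = d - 1 - t" using Suc.prems by simp
    finally show ?case using Suc by simp
  qed (use assms(2) in simp)
  have eq: "f t = f 0" if "t < d" for t
    using up[OF that] down[of "d - 1 - t"] that by simp
  have "(\<Sum>t<d. f t) = (\<Sum>t<d. f 0)" by (rule sum.cong[OF refl], rule eq) simp
  then show ?thesis by simp
qed

text \<open>Distribute the chords over the \<open>d\<close> blocks of \<open>g\<close> consecutive vertices according to the
  starting point of their shorter arc, which only diameters lack.\<close>

lemma order_dvd_card:
  assumes n: "n = d * g" "g > 0" "d \<ge> 2" and D: "D \<in> nc (inner 0 (n - 1))"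
    and inv: "act (rot n g) ` D = D"
    and nodiam: "\<And>c. c \<in> D \<Longrightarrow> 2 * (snd c - fst c) \<noteq> n"
  shows "d dvd card D"
proof -
  define start where "start c = (if 2 * (snd c - fst c) < n then fst c else snd c)" for c :: "nat \<times> nat"
  have gn: "g < n" using n by simp
  have s: "D \<subseteq> inner 0 (n - 1)" using D by (simp add: nc_def)
  have fin: "finite D" using nc_finite[OF finite_inner D] .
  have start: "start c < n" "start (act (rot n g) c) = rot n g (start c)" if "c \<in> D" for c
  proof -
    have c: "fst c < n" "snd c < n" "fst c + 2 \<le> snd c" using innerD[of c n] that s by auto
    then show "start c < n" by (simp add: start_def)
    have "2 * (snd c - fst c) \<noteq> n" using nodiam[OF that] .
    then show "start (act (rot n g) c) = rot n g (start c)"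
      using c gn by (simp add: act_rot rot_if start_def) linarith
  qed
  define E where "E t = {c \<in> D. start c div g = t}" for t
  have le: "card (E t) \<le> card (E t')"
    if "\<And>x. x < n \<Longrightarrow> x div g = t \<Longrightarrow> rot n g x div g = t'" for t t'
  proof (rule card_inj_on_le)
    show "inj_on (act (rot n g)) (E t)"
      using bij_betw_imp_inj_on[OF bij_betw_act[OF symmetry_rot[OF gn]]]
      by (rule inj_on_subset) (use s in \<open>auto simp: E_def\<close>)
    show "act (rot n g) ` E t \<subseteq> E t'"
      using inv start that by (auto simp: E_def)
    show "finite (E t')" using fin by (simp add: E_def)
  qed
  have "card D = card (\<Union>t<d. E t)"
  proof (rule arg_cong[where f = card])
    have "start c div g < d" if "c \<in> D" for c
      using start(1)[OF that] n by (simp add: less_mult_imp_div_less)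
    then show "D = (\<Union>t<d. E t)" by (auto simp: E_def)
  qed
  also have "\<dots> = (\<Sum>t<d. card (E t))"
    by (rule card_UN_disjoint) (use fin in \<open>auto simp: E_def\<close>)
  also have "\<dots> = d * card (E 0)"
  proof (rule card_eq_of_cyclic_le)
    fix t assume t: "Suc t < d"
    show "card (E t) \<le> card (E (Suc t))"
    proof (rule le)
      fix x assume x: "x < n" "x div g = t"
      have "x < Suc t * g" using dividend_less_div_times[OF n(2), of x] x by simp
      moreover have "Suc (Suc t) * g \<le> n" using t unfolding n(1) by (intro mult_le_mono1) simp
      ultimately have "x + g < n" by simp
      then show "rot n g x div g = Suc t" using x n gn by (simp add: rot_if)
    qed
  next
    show "card (E (d - 1)) \<le> card (E 0)"
    proof (rule le)
      fix x assume x: "x < n" "x div g = d - 1"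
      have "(d - 1) * g \<le> x" using x(2) by (metis div_times_less_eq_dividend)
      then have "n \<le> x + g" using n by (simp add: diff_mult_distrib)
      then show "rot n g x div g = 0" using x gn by (simp add: rot_if)
    qed
  qed
  finally show ?thesis by simp
qed

text \<open>As \<open>3 * g \<le> n\<close>, the rotation by \<open>g\<close> is less than half a
  turn and takes a diameter to a different one; two diameters cross.\<close>

lemma no_diameter:
  assumes n: "n = d * g" "g > 0" "d \<ge> 3" and D: "D \<in> nc (inner 0 (n - 1))"
    and inv: "act (rot n g) ` D = D" and c: "c \<in> D"
  shows "2 * (snd c - fst c) \<noteq> n"
proof
  assume diam: "2 * (snd c - fst c) = n"
  have "3 * g \<le> n" using n by simp
  moreover have "fst c + 2 \<le> snd c" "snd c < n" using innerD[of c n] c D by (auto simp: nc_def)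
  ultimately have "crosses c (act (rot n g) c)"
    using diam n(2) by (auto simp: act_rot crosses_def)
  moreover have "act (rot n g) c \<in> D" using inv c by blast
  ultimately show False using nc_not_crosses[OF D c] by blast
qed

lemma rotation_orders:
  assumes n: "n \<ge> 5" and r: "0 < r" "r < n" and D: "D \<in> fixed_dissections n (n - 5) (rot n r)"
  shows "2 * r = n \<or> n = 5 * gcd r n"
proof -
  define g where "g = gcd r n"
  define d where "d = n div g"
  have D': "D \<in> nc (inner 0 (n - 1))" "card D = n - 5" and inv: "act (rot n g) ` D = D"
    using D rot_invariant_gcd[of D n r] r by (auto simp: fixed_dissections_def g_def)
  have gd: "n = d * g" "g > 0" using r by (simp_all add: d_def g_def)
  have "g \<le> r" using r by (simp add: g_def gcd_le1_nat)
  moreover have "d \<noteq> 0" using gd(1) r by (intro notI) simp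
  ultimately have "d \<noteq> 0" "d \<noteq> 1" using gd r by auto
  then have d2: "d \<ge> 2" by linarith
  show ?thesis
  proof (cases "d = 2")
    case True
    obtain q where q: "r = g * q" unfolding g_def by (metis dvdE gcd_dvd1)
    then have "q < 2" "q > 0" using r gd True by auto
    then have "q = 1" by simp
    then show ?thesis using q gd True by simp
  next
    case False
    then have "d \<ge> 3" using d2 by simp
    then have "d dvd n - 5"
      using order_dvd_card[OF gd d2 D'(1) inv] no_diameter[OF gd _ D'(1) inv] D'(2) by auto
    moreover have "d dvd n" using gd by simp
    ultimately have "d dvd n - (n - 5)" by (rule dvd_diff_nat[rotated])
    then have "d dvd 5" using n by simp
    then have "d = 3 \<or> d = 4 \<or> d = 5" using \<open>d \<ge> 3\<close> dvd_imp_le[of d 5] by linarith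
    then have "d = 5" using \<open>d dvd 5\<close> by auto
    then show ?thesis using gd by (simp add: g_def)
  qed
qed

lemma invariantI:
  assumes "symmetry n \<sigma>" "D \<in> nc (inner 0 (n - 1))" "act \<sigma> ` D \<subseteq> D"
  shows "act \<sigma> ` D = D"
proof (rule endo_inj_surj)
  show "finite D" using nc_finite[OF finite_inner assms(2)] .
  show "inj_on (act \<sigma>) D"
    using bij_betw_imp_inj_on[OF bij_betw_act[OF assms(1)]] assms(2)
    by (auto simp: nc_def intro: inj_on_subset)
qed (rule assms)

section \<open>Dissections made of rotated copies of one sector\<close>

context
  fixes n d m :: nat
  assumes n: "n = d * m" and d: "d \<ge> 2" and m: "m \<ge> 2"
begin

definition sector :: "nat \<Rightarrow> nat \<times> nat \<Rightarrow> nat \<times> nat" where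
  "sector t c = act (rot n (t * m)) c"

text \<open>The set \<open>S\<close> lies under the chord \<open>(0, m)\<close>, whose rotated
  copies are the sides of a central d-gon; for \<open>d = 2\<close> this degenerates to a
  diameter.\<close>

definition unfold_sector :: "(nat \<times> nat) set \<Rightarrow> (nat \<times> nat) set" where
  "unfold_sector S = (\<Union>t<d. sector t ` insert (0, m) S)"

lemma two_m_le: "2 * m \<le> n"
  using n d by simp

lemma sector_le: "t < d \<Longrightarrow> t * m + m \<le> n"
  using mult_le_mono1[of "Suc t" d m] n by simp

lemma sector_lt: "t < d \<Longrightarrow> t * m < n"
  using sector_le[of t] m by simp

lemma sector_mono: "t < t' \<Longrightarrow> t * m + m \<le> t' * m"
  using mult_le_mono1[of "Suc t" t' m] by simp

lemma insert_base: "insert (0, m) (inner 0 m) = chords 0 m"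
  using m by (auto simp: inner_def chords_def)

lemma chords_subset_inner: "chords 0 m \<subseteq> inner 0 (n - 1)"
  using two_m_le m by (auto simp: inner_def chords_def)

text \<open>Only a chord ending at \<open>m\<close>, moved to the last sector, reaches position
  \<open>n\<close>, which is vertex 0; its end points then change order.\<close>

lemma sector_eq:
  assumes "t < d" "c \<in> chords 0 m"
  shows "sector t c = (if snd c + t * m < n then (fst c + t * m, snd c + t * m) else (0, fst c + t * m))"
    and "snd c + t * m \<ge> n \<Longrightarrow> snd c = m \<and> t = d - 1"
proof -
  have c: "fst c + 2 \<le> snd c" "snd c \<le> m" using assms(2) by (auto simp: chords_def)
  have t: "t * m + m \<le> n" using sector_le[OF assms(1)] .
  show "sector t c = (if snd c + t * m < n then (fst c + t * m, snd c + t * m) else (0, fst c + t * m))"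
    using c t m sector_lt[OF assms(1)] two_m_le unfolding sector_def by (auto simp: act_rot)
  show "snd c = m \<and> t = d - 1" if "snd c + t * m \<ge> n"
  proof (rule ccontr)
    assume "\<not> ?thesis"
    moreover have "snd c = m" using that c t by simp
    ultimately have "t < d - 1" using assms(1) by simp
    then have "Suc (Suc t) * m \<le> n" unfolding n by (intro mult_le_mono1) simp
    then show False using that c m by simp
  qed
qed

lemma sector_range:
  assumes "t < d" "c \<in> chords 0 m"
  shows "t * m \<le> fst (sector t c) \<and> fst (sector t c) + 2 \<le> snd (sector t c) \<and> snd (sector t c) \<le> t * m + m \<or>
    t = d - 1 \<and> fst (sector t c) = 0 \<and> snd (sector t c) = t * m + fst c \<and> snd c = m"
  using sector_eq[OF assms] assms(2) by (auto simp: chords_def split: if_splits)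

text \<open>One of the two chords must not be the base: for \<open>d = 2\<close> both rotated bases
  are the same diameter.\<close>

lemma sector_disjoint:
  assumes "t < d" "t' < d" "c \<in> inner 0 m" "c' \<in> chords 0 m" "t \<noteq> t'"
  shows "sector t c \<noteq> sector t' c'"
proof
  assume eq: "sector t c = sector t' c'"
  have c: "c \<in> chords 0 m" "snd c = m \<Longrightarrow> fst c > 0"
    using assms(3) by (auto simp: inner_def prod_eq_iff)
  have b: "snd c \<le> m" "fst c < m" using assms(3,4) by (auto simp: inner_def chords_def)
  consider "t < t'" | "t' < t" using assms(5) by linarith
  then show False
  proof cases
    case 1
    then have "t \<noteq> d - 1" using assms(2) by simp
    then have "sector t c = (fst c + t * m, snd c + t * m)"
      using sector_eq[OF assms(1) c(1)] by auto
    moreover define X Y where XY: "X = t * m" "Y = t' * m"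
    ultimately have "fst (sector t' c') = fst c + X" "snd (sector t' c') = snd c + X"
      using eq by auto
    then show False
      using sector_range[OF assms(2,4), folded XY] sector_mono[OF 1, folded XY] c b m by auto
  next
    case 2
    then have "t' \<noteq> d - 1" using assms(1) by simp
    then show False
      using eq sector_range[OF assms(1) c(1)] sector_range[OF assms(2,4)] sector_mono[OF 2] c(2) m
      by auto
  qed
qed

lemma unfold_sector_nc:
  assumes S: "S \<in> nc (inner 0 m)"
  shows "unfold_sector S \<in> nc (inner 0 (n - 1))" "act (rot n m) ` unfold_sector S = unfold_sector S"
    "(0, m) \<in> unfold_sector S"
proof -
  define T where "T = insert (0, m) S"
  have T: "T \<in> nc (chords 0 m)" unfolding T_def by (rule insert_base_nc[OF m S])
  then have Ts: "T \<subseteq> chords 0 m" by (simp add: nc_def)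
  have sub: "sector t c \<in> inner 0 (n - 1)" if "t < d" "c \<in> T" for t c
    using symmetry_rot[OF sector_lt[OF that(1)]] that(2) Ts chords_subset_inner
    unfolding sector_def symmetry_def by blast
  have ncr: "\<not> crosses (sector t c) (sector t' c')"
    if "t < t'" "t' < d" "c \<in> chords 0 m" "c' \<in> chords 0 m" for t t' c c'
    using sector_range[of t c] sector_range[of t' c'] sector_mono[OF that(1)] that
    by (auto simp: crosses_def)
  have sym: "crosses x y \<longleftrightarrow> crosses y x" for x y by (auto simp: crosses_def)
  have "\<not> crosses (sector t c) (sector t' c')"
    if t: "t < d" "t' < d" "c \<in> T" "c' \<in> T" for t t' c c'
  proof (cases "t = t'")
    case True
    have "crosses (sector t c) (sector t c') \<longleftrightarrow> crosses c c'"
      using symmetry_rot[OF sector_lt[OF t(1)]] t(3,4) Ts chords_subset_inner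
      unfolding sector_def symmetry_def by blast
    then show ?thesis using nc_not_crosses[OF T t(3,4)] True by simp
  next
    case False
    then consider "t < t'" | "t' < t" by linarith
    then show ?thesis
    proof cases
      case 1
      then show ?thesis using ncr t Ts by blast
    next
      case 2
      then show ?thesis using ncr t Ts sym by blast
    qed
  qed
  then show nc: "unfold_sector S \<in> nc (inner 0 (n - 1))"
    using sub unfolding nc_def unfold_sector_def T_def[symmetric] by auto
  show "act (rot n m) ` unfold_sector S = unfold_sector S"
  proof (rule invariantI[OF _ nc])
    show "symmetry n (rot n m)" using two_m_le m by (intro symmetry_rot) simp
    show "act (rot n m) ` unfold_sector S \<subseteq> unfold_sector S"
    proof
      fix e assume "e \<in> act (rot n m) ` unfold_sector S"
      then obtain t c where tc: "t < d" "c \<in> T" and e: "e = act (rot n m) (sector t c)"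
        unfolding unfold_sector_def T_def[symmetric] by auto
      have e': "e = act (rot n (Suc t * m)) c" unfolding e sector_def act_rot_rot by simp
      show "e \<in> unfold_sector S"
      proof (cases "Suc t < d")
        case True
        then show ?thesis using tc(2) unfolding e' unfold_sector_def T_def[symmetric] sector_def by blast
      next
        case False
        then have "Suc t = d" using tc(1) by simp
        then have "e = act (rot n (0 * m)) c"
          using e' act_rot_0[of c n] n tc(2) Ts chords_subset_inner by auto
        then show ?thesis using tc(2) d unfolding unfold_sector_def T_def[symmetric] sector_def
          by (intro UN_I[of 0]) auto
      qed
    qed
  qed
  have "(0, m) \<in> inner 0 (n - 1)" using chords_subset_inner insert_base by blast
  then have "sector 0 (0, m) = (0, m)" using act_rot_0(1) by (simp add: sector_def)
  then show "(0, m) \<in> unfold_sector S" unfolding unfold_sector_def using d by (intro UN_I[of 0]) force+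
qed

text \<open>A chord of another sector that ends at \<open>m\<close> or earlier can only be
  \<open>(0, m)\<close> itself, which happens for \<open>d = 2\<close>; removing the base thus
  leaves just the first copy of \<open>S\<close>.\<close>

lemma restrict_unfold_sector:
  assumes S: "S \<in> nc (inner 0 m)"
  shows "{c \<in> unfold_sector S. snd c \<le> m \<and> c \<noteq> (0, m)} = S"
proof -
  have s: "insert (0, m) S \<subseteq> chords 0 m" using S insert_base by (auto simp: nc_def)
  have "sector t c \<in> S" if "t < d" "c \<in> insert (0, m) S" "snd (sector t c) \<le> m" "sector t c \<noteq> (0, m)" for t c
  proof (cases "t = 0")
    case True
    then have "sector t c = c" using that(2) s chords_subset_inner act_rot_0(1)[of c n]
      by (auto simp: sector_def)
    then show ?thesis using that by auto
  next
    case False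
    moreover define X where "X = t * m"
    ultimately have "m \<le> X" by simp
    moreover have "c \<in> chords 0 m" using that(2) s by blast
    ultimately have "sector t c = (0, m)"
      using sector_range[OF that(1), of c, folded X_def] that(3) m by (auto simp: prod_eq_iff)
    then show ?thesis using that by simp
  qed
  moreover have "c \<in> unfold_sector S \<and> snd c \<le> m \<and> c \<noteq> (0, m)" if "c \<in> S" for c
  proof -
    have "c \<in> chords 0 m" using that s by blast
    then have "sector 0 c = c" using chords_subset_inner act_rot_0(1)[of c n] by (auto simp: sector_def)
    then have "c \<in> unfold_sector S" unfolding unfold_sector_def using d that by (intro UN_I[of 0]) force+
    then show ?thesis using nc_innerD[OF S that] by blast
  qed
  ultimately show ?thesis unfolding unfold_sector_def by blast
qed

text \<open>A chord whose span lies strictly between \<open>m\<close> and \<open>n - m\<close>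
  crosses its own rotation by \<open>m\<close>. Any other chord is confined to one sector, as it
  would otherwise cross a rotated base.\<close>

lemma unfold_sector_restrict:
  assumes D: "D \<in> nc (inner 0 (n - 1))" and inv: "act (rot n m) ` D = D" and base: "(0, m) \<in> D"
  shows "{c \<in> D. snd c \<le> m \<and> c \<noteq> (0, m)} \<in> nc (inner 0 m)"
    and "unfold_sector {c \<in> D. snd c \<le> m \<and> c \<noteq> (0, m)} = D"
proof -
  let ?S = "{c \<in> D. snd c \<le> m \<and> c \<noteq> (0, m)}"
  show "?S \<in> nc (inner 0 m)"
    by (rule nc_subset[OF D]) (use D in \<open>auto simp: nc_def inner_def chords_def\<close>)
  have ins: "insert (0, m) ?S = {c \<in> D. snd c \<le> m}" using base by auto
  have tD: "sector t c \<in> D" if "c \<in> D" for t c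
    using rot_invariant_mult[OF D inv, of t] that by (auto simp: sector_def)
  have "e \<in> unfold_sector ?S" if e: "e \<in> D" for e
  proof -
    obtain i j where ij: "e = (i, j)" by (cases e)
    have b: "i + 2 \<le> j" "j < n" using e nc_innerD[OF D e] ij by auto
    have short: "j - i \<le> m \<or> n - m \<le> j - i"
    proof (rule ccontr)
      assume "\<not> ?thesis"
      then have "crosses e (act (rot n m) e)" using b ij m two_m_le by (auto simp: act_rot crosses_def)
      moreover have "act (rot n m) e \<in> D" using inv e by blast
      ultimately show False using nc_not_crosses[OF D e] by blast
    qed
    have bt: "(t * m, t * m + m) \<in> D" if "t * m + m < n" for t
    proof -
      have "t < d" using that n by (metis add_lessD1 mult_less_cancel2)
      moreover have "(0, m) \<in> chords 0 m" using m by (simp add: chords_def)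
      ultimately show ?thesis using tD[OF base, of t] sector_eq(1)[of t "(0, m)"] that
        by (simp add: add.commute)
    qed
    \<comment> \<open>Rotating on by the missing \<open>d - t\<close> sectors completes a full turn,
      so \<open>e\<close> returns to \<open>c\<close>, which therefore belongs to
      \<open>D\<close>.\<close>
    have lift: "e \<in> unfold_sector ?S" if t: "t < d" "c \<in> inner 0 (n - 1)" "snd c \<le> m" "e = sector t c" for t c
    proof -
      have "sector (d - t) e = act (rot n n) c"
        unfolding t(4) sector_def act_rot_rot using t(1) n by (simp add: distrib_right[symmetric])
      then have "sector (d - t) e = c" using act_rot_0[OF t(2)] by simp
      then have "c \<in> D" using tD[OF e, of "d - t"] by simp
      then show ?thesis using t unfolding unfold_sector_def ins by blast
    qed
    show ?thesis
    proof (cases "j - i \<le> m")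
      case True
      define t where "t = i div m"
      have ti: "t * m \<le> i" "i < t * m + m"
        using dividend_less_div_times[of m i] m by (auto simp: t_def)
      have t: "t < d" using b n unfolding t_def by (simp add: less_mult_imp_div_less)
      have j: "j \<le> t * m + m"
      proof (rule ccontr)
        assume "\<not> ?thesis"
        then have "crosses (t * m, t * m + m) e" "t * m + m < n"
          using ti True b ij by (auto simp: crosses_def)
        then show False using nc_not_crosses[OF D bt e] by blast
      qed
      have c: "(i - t * m, j - t * m) \<in> chords 0 m" using ti j b by (auto simp: chords_def)
      show ?thesis
      proof (rule lift[OF t])
        show "(i - t * m, j - t * m) \<in> inner 0 (n - 1)" using c chords_subset_inner by blast
        show "snd (i - t * m, j - t * m) \<le> m" using j by simp
        show "e = sector t (i - t * m, j - t * m)" using sector_eq(1)[OF t c] ti b ij by simp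
      qed
    next
      case False
      \<comment> \<open>Seen from its other side, such a chord belongs to the last sector and ends
        at position \<open>n\<close>, that is, at vertex 0: any \<open>i > 0\<close> would make it
        cross the base \<open>(0, n - m)\<close> of that sector.\<close>
      then have long: "n - m \<le> j - i" using short by simp
      have dm: "(d - 1) * m = n - m" "d - 1 < d" using n d by (simp_all add: diff_mult_distrib)
      have "sector (d - 1) (0, m) = (0, n - m)"
        using sector_eq(1)[OF dm(2), of "(0, m)"] dm two_m_le m by (simp add: chords_def)
      then have "(0, n - m) \<in> D" using tD[OF base, of "d - 1"] by simp
      then have "\<not> crosses (0, n - m) e" using nc_not_crosses[OF D _ e] by blast
      then have i: "i = 0" using long b ij two_m_le by (auto simp: crosses_def)
      have c: "(j - (n - m), m) \<in> inner 0 (n - 1)"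
        using long i b two_m_le m nc_innerD[OF D e] ij by (auto simp: inner_def chords_def)
      then have c': "(j - (n - m), m) \<in> chords 0 m" by (auto simp: inner_def chords_def)
      show ?thesis
      proof (rule lift[OF dm(2) c])
        show "e = sector (d - 1) (j - (n - m), m)"
          using sector_eq(1)[OF dm(2) c'] long i b ij dm two_m_le by auto
      qed simp
    qed
  qed
  moreover have "unfold_sector ?S \<subseteq> D" unfolding unfold_sector_def ins using tD by blast
  ultimately show "unfold_sector ?S = D" by blast
qed

lemma inj_sector: "t < d \<Longrightarrow> inj_on (sector t) (inner 0 (n - 1))"
  unfolding sector_def by (rule bij_betw_imp_inj_on[OF bij_betw_act[OF symmetry_rot[OF sector_lt]]])

text \<open>Copies of \<open>S\<close> never coincide; the bases do only for \<open>d = 2\<close>,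
  whence the conditional.\<close>

lemma card_unfold_sector:
  assumes S: "S \<in> nc (inner 0 m)"
  shows "card (unfold_sector S) = (if d = 2 then 1 else d) + d * card S"
proof -
  have s: "S \<subseteq> inner 0 m" using S by (simp add: nc_def)
  have bc: "(0, m) \<in> chords 0 m" "inner 0 m \<subseteq> chords 0 m" using insert_base by blast+
  let ?B = "(\<lambda>t. sector t (0, m)) ` {..<d}" and ?T = "(\<lambda>(t, c). sector t c) ` ({..<d} \<times> S)"
  have un: "unfold_sector S = ?B \<union> ?T" unfolding unfold_sector_def by auto
  have ne: "sector t c \<noteq> sector t' c'" if "t < d" "t' < d" "c \<in> S" "c' \<in> chords 0 m" "(t, c) \<noteq> (t', c')" for t t' c c'
  proof (cases "t = t'")
    case True
    then have "c \<noteq> c'" using that by simp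
    then show ?thesis
      using True inj_onD[OF inj_sector[OF that(1)], of c c'] that s bc chords_subset_inner by blast
  next
    case False
    then show ?thesis using sector_disjoint[OF that(1,2) _ that(4)] that(3) s by blast
  qed
  have "inj_on (\<lambda>(t, c). sector t c) ({..<d} \<times> S)"
    using ne s bc by (auto intro!: inj_onI) blast+
  then have T: "card ?T = d * card S" by (simp add: card_image card_cartesian_product)
  have "(0, m) \<notin> S" using s by (auto simp: inner_def)
  then have dis: "?B \<inter> ?T = {}" using ne bc by fastforce
  have B: "card ?B = (if d = 2 then 1 else d)"
  proof (cases "d = 2")
    case True
    have "sector 1 (0, m) = (0, m)" "sector 0 (0, m) = (0, m)"
      using sector_eq(1)[of 1 "(0, m)"] sector_eq(1)[of 0 "(0, m)"] bc d n m True by auto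
    moreover have "{..<d} = {0, 1}" using True by auto
    ultimately have "?B = {(0, m)}" by simp
    then show ?thesis using True by simp
  next
    case False
    have "inj_on (\<lambda>t. sector t (0, m)) {..<d}"
    proof (rule linorder_inj_onI)
      fix t t' assume t: "t < t'" "t \<in> {..<d}" "t' \<in> {..<d}"
      then have "t \<noteq> d - 1" by auto
      then have "sector t (0, m) = (t * m, m + t * m)"
        using sector_eq[of t "(0, m)"] t bc by auto
      moreover have "sector t' (0, m) = (t' * m, m + t' * m) \<or> t' = d - 1 \<and> sector t' (0, m) = (0, t' * m)"
        using sector_eq[of t' "(0, m)"] t bc by (auto split: if_splits)
      \<comment> \<open>The wrapped base of the last sector starts at 0 like the first one;
        \<open>d \<ge> 3\<close> puts its other end beyond \<open>m\<close>.\<close>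
      moreover have "t' = d - 1 \<Longrightarrow> 2 * m \<le> t' * m" using False d by auto
      ultimately show "sector t (0, m) \<noteq> sector t' (0, m)"
        using sector_mono[OF t(1)] m by auto
    qed auto
    then show ?thesis using False by (simp add: card_image)
  qed
  have "finite S" using nc_finite[OF finite_inner S] .
  then show ?thesis unfolding un using T B dis by (subst card_Un_disjoint) auto
qed

lemma card_fixed_with_base:
  "card {D \<in> fixed_dissections n k (rot n m). (0, m) \<in> D} =
   card {S \<in> nc (inner 0 m). (if d = 2 then 1 else d) + d * card S = k}"
proof -
  have bij: "bij_betw unfold_sector (nc (inner 0 m))
      {D \<in> nc (inner 0 (n - 1)). act (rot n m) ` D = D \<and> (0, m) \<in> D}"
  proof (rule bij_betw_byWitness[where f' = "\<lambda>D. {c \<in> D. snd c \<le> m \<and> c \<noteq> (0, m)}"])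
    show "unfold_sector ` nc (inner 0 m) \<subseteq>
        {D \<in> nc (inner 0 (n - 1)). act (rot n m) ` D = D \<and> (0, m) \<in> D}"
      using unfold_sector_nc by blast
  qed (use restrict_unfold_sector unfold_sector_restrict in blast)+
  have "{D \<in> fixed_dissections n k (rot n m). (0, m) \<in> D} =
     {D \<in> {D \<in> nc (inner 0 (n - 1)). act (rot n m) ` D = D \<and> (0, m) \<in> D}. card D = k}"
    by (auto simp: fixed_dissections_def)
  then show ?thesis
    using bij_betw_card_filter[OF bij, where P = "\<lambda>S. (if d = 2 then 1 else d) + d * card S = k"
        and Q = "\<lambda>D. card D = k"] card_unfold_sector by simp
qed

end

section \<open>Counts for the half turn and the fifth turns\<close>

text \<open>Apart from the diameter there are n - 6 chords, so h - 3 on either side, one less than a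
  triangulated half has.\<close>

lemma diameter_with_base:
  assumes "n = 2 * h" "h \<ge> 3"
  shows "card {D \<in> fixed_dissections n (n - 5) (rot n h). (0, h) \<in> D} = num_open 1 h"
proof -
  have "(1 + 2 * card S = n - 5) = (card S + 1 + 2 = h)" for S :: "(nat \<times> nat) set"
    using assms by linarith
  then show ?thesis
    using card_fixed_with_base[OF assms(1), of "n - 5"] assms by (simp add: num_open_def)
qed

lemma card_fixed_translate:
  assumes "r < n" "s < n" "c \<in> inner 0 (n - 1)"
  shows "card {D \<in> fixed_dissections n k (rot n r). c \<in> D} =
    card {D \<in> fixed_dissections n k (rot n r). act (rot n s) c \<in> D}"
proof (rule card_fixed_conj[OF symmetry_rot[OF assms(2)] symmetry_rot[OF assms(1)]])
  show "rot n r (rot n s i) = rot n s (rot n r i)" for i by (simp add: rot_rot add.commute)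
  fix D assume "D \<in> nc (inner 0 (n - 1))"
  then show "act (rot n s) c \<in> act (rot n s) ` D \<longleftrightarrow> c \<in> D"
    using inj_on_image_mem_iff[OF bij_betw_imp_inj_on[OF bij_betw_act[OF symmetry_rot[OF assms(2)]]] assms(3)]
    by (simp add: nc_def)
qed

text \<open>Because of \<open>p \<le> l\<close> the candidates \<open>(s, s + l)\<close> with
  \<open>s < p\<close> cross pairwise, so a fixed dissection contains exactly one of them. Rotations
  commute, hence each \<open>s\<close> occurs equally often.\<close>

lemma card_fixed_by_unique_chord:
  assumes r: "r < n" and base: "(0, l) \<in> inner 0 (n - 1)" and p: "p + l \<le> n"
    and ex: "\<And>D. D \<in> fixed_dissections n k (rot n r) \<Longrightarrow> \<exists>s<p. (s, s + l) \<in> D"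
    and l: "p \<le> l"
  shows "card (fixed_dissections n k (rot n r)) =
    p * card {D \<in> fixed_dissections n k (rot n r). (0, l) \<in> D}"
proof -
  let ?F = "\<lambda>s. {D \<in> fixed_dissections n k (rot n r). (s, s + l) \<in> D}"
  have fin: "finite (fixed_dissections n k (rot n r))"
    by (simp add: fixed_dissections_def finite_nc)
  have "fixed_dissections n k (rot n r) = (\<Union>s<p. ?F s)" using ex by blast
  from arg_cong[OF this, of card]
  have "card (fixed_dissections n k (rot n r)) = card (\<Union>s<p. ?F s)" .
  also have "\<dots> = (\<Sum>s<p. card (?F s))"
  proof (rule card_UN_disjoint)
    show "\<forall>s\<in>{..<p}. \<forall>s'\<in>{..<p}. s \<noteq> s' \<longrightarrow> ?F s \<inter> ?F s' = {}"
    proof (intro ballI impI)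
      fix s s' assume "s \<in> {..<p}" "s' \<in> {..<p}" "s \<noteq> s'"
      then have "crosses (s, s + l) (s', s' + l)" using l by (auto simp: crosses_def)
      then have "\<not> ((s, s + l) \<in> D \<and> (s', s' + l) \<in> D)" if "D \<in> fixed_dissections n k (rot n r)" for D
        using that nc_not_crosses[of D "inner 0 (n - 1)"] by (auto simp: fixed_dissections_def)
      then show "?F s \<inter> ?F s' = {}" by blast
    qed
  qed (use fin in auto)
  also have "\<dots> = (\<Sum>s<p. card (?F 0))"
  proof (rule sum.cong)
    fix s assume "s \<in> {..<p}"
    moreover have "0 < l" "l < n" using base by (auto simp: inner_def chords_def)
    ultimately have "s < n" "act (rot n s) (0, l) = (s, s + l)"
      using p by (auto simp: act_rot)
    then show "card (?F s) = card (?F 0)" using card_fixed_translate[OF r _ base, of s k] by simp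
  qed simp
  finally show ?thesis by simp
qed

lemma card_fixed_half_turn:
  assumes n: "n = 2 * h" "h \<ge> 3"
  shows "card (fixed_dissections n (n - 5) (rot n h)) = h * num_open 1 h"
proof -
  have "card (fixed_dissections n (n - 5) (rot n h)) =
      h * card {D \<in> fixed_dissections n (n - 5) (rot n h). (0, h) \<in> D}"
  proof (rule card_fixed_by_unique_chord)
    fix D assume "D \<in> fixed_dissections n (n - 5) (rot n h)"
    then have D: "D \<in> nc (inner 0 (n - 1))" "act (rot n h) ` D = D" "card D = n - 5"
      by (auto simp: fixed_dissections_def)
    \<comment> \<open>Without a diameter the half turn would pair off the chords, but n - 5 is
      odd.\<close>
    have "\<not> 2 dvd card D" using D(3) n by presburger
    then obtain c where c: "c \<in> D" "2 * (snd c - fst c) = n"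
      using order_dvd_card[of n 2 h D] D n by auto
    have "c = (fst c, fst c + h)" "fst c < h" using c nc_innerD[OF D(1) c(1)] n by (auto simp: prod_eq_iff)
    then show "\<exists>s<h. (s, s + h) \<in> D" using c(1) by metis
  qed (use n in \<open>auto simp: inner_def chords_def\<close>)
  then show ?thesis using diameter_with_base[OF n] by simp
qed

text \<open>A chord of maximal length cannot exceed length \<open>m\<close>, as it would cross its own rotation. If it
  were shorter, no chord would cross \<open>(0, m)\<close>, \<open>(m, 2m)\<close> or \<open>(2m, 3m)\<close>, and adding
  these three would exceed the maximal number of chords.\<close>

lemma longest_chord_fifth_turn:
  assumes n: "n = 5 * m" "m \<ge> 2" and D: "D \<in> nc (inner 0 (n - 1))" "act (rot n m) ` D = D" "card D = n - 5"
    and l: "(0, l) \<in> D" "2 * l \<le> n"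
    and max: "\<And>c. c \<in> D \<Longrightarrow> snd c - fst c \<le> l \<or> n - (snd c - fst c) \<le> l"
  shows "l = m"
proof (rule ccontr)
  assume "l \<noteq> m"
  have l2: "l \<ge> 2" using nc_innerD[OF D(1) l(1)] by simp
  have tl: "(t * m, t * m + l) \<in> D" if "t * m + l < n" for t
  proof -
    have "act (rot n (t * m)) (0, l) \<in> D" using rot_invariant_mult[OF D(1,2), of t] l(1) by blast
    then show ?thesis using that l2 by (simp add: act_rot add.commute)
  qed
  have "\<not> crosses (0, l) (m, m + l)"
    using nc_not_crosses[OF D(1) l(1)] tl[of 1] l n by auto
  then have lm: "l < m" using \<open>l \<noteq> m\<close> n by (auto simp: crosses_def)
  \<comment> \<open>Both arcs of a chord crossing \<open>(x, x + m)\<close> would properly contain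
    one of the copies of the longest chord at \<open>x\<close> and \<open>x + m\<close>, so its
    length would exceed \<open>l\<close>.\<close>
  have no: "\<not> crosses c (x, x + m) \<and> (x, x + m) \<noteq> c"
    if c: "c \<in> D" and x: "(x, x + l) \<in> D" "(x + m, x + m + l) \<in> D" "x \<le> 2 * m" for c x
  proof -
    have b: "fst c + 2 \<le> snd c" "snd c < n" using nc_innerD[OF D(1) c] n by auto
    have "\<not> crosses c (x, x + l)" "\<not> crosses c (x + m, x + m + l)"
      using nc_not_crosses[OF D(1) c] x by blast+
    then show ?thesis using max[OF c] b lm x(3) n l2 by (auto simp: crosses_def)
  qed
  \<comment> \<open>Three of the five sides of the central pentagon suffice: n - 5 + 3 exceeds the
    maximum n - 3, and none of the three wraps past vertex 0.\<close>
  define N where "N = {(0, m), (m, 2 * m), (2 * m, 3 * m)}"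
  have chain: "(0, 0 + l) \<in> D" "(m, m + l) \<in> D" "(2 * m, 2 * m + l) \<in> D" "(3 * m, 3 * m + l) \<in> D"
    using tl[of 0] tl[of 1] tl[of 2] tl[of 3] lm n by auto
  have N: "\<not> crosses c e \<and> e \<noteq> c" if "c \<in> D" "e \<in> N" for c e
    using no[OF that(1), of 0] no[OF that(1), of m] no[OF that(1), of "2 * m"] that(2) chain
    by (auto simp: N_def mult_2[symmetric])
  have sym: "crosses x y \<longleftrightarrow> crosses y x" for x y by (auto simp: crosses_def)
  have NN: "\<not> crosses c e" if "c \<in> N" "e \<in> N" for c e
    using that by (auto simp: N_def crosses_def)
  have "D \<union> N \<in> nc (inner 0 (n - 1))"
    unfolding nc_def
  proof (intro CollectI conjI ballI)
    have "N \<subseteq> inner 0 (n - 1)" using n by (auto simp: N_def inner_def chords_def)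
    then show "D \<union> N \<subseteq> inner 0 (n - 1)" using D(1) by (auto simp: nc_def)
    fix c e assume "c \<in> D \<union> N" "e \<in> D \<union> N"
    then show "\<not> crosses c e" using N NN nc_not_crosses[OF D(1)] sym by blast
  qed
  then have "card (D \<union> N) + 2 \<le> n - 1 - 0" using n by (intro card_nc_inner) auto
  moreover have "card (D \<union> N) = card D + card N"
    using nc_finite[OF finite_inner D(1)] N by (intro card_Un_disjoint) (auto simp: N_def)
  moreover have "card N = 3" using n by (simp add: N_def)
  ultimately show False using D(3) n by simp
qed

text \<open>A chord of greatest cyclic length is rotated to vertex 0, where its length turns out to
  be \<open>m\<close>, and back again. Invariance under multiples of \<open>m\<close> then reduces
  its starting point modulo \<open>m\<close>.\<close>

lemma ex_chord_fifth_turn: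
  assumes n: "n = 5 * m" "m \<ge> 2" and F: "D \<in> fixed_dissections n (n - 5) (rot n m)"
  shows "\<exists>s<m. (s, s + m) \<in> D"
proof -
  have D: "D \<in> nc (inner 0 (n - 1))" "act (rot n m) ` D = D" "card D = n - 5"
    using F by (auto simp: fixed_dissections_def)
  have mn: "m < n" using n by simp
  define len where "len c = min (snd c - fst c) (n - (snd c - fst c))" for c :: "nat \<times> nat"
  have len_act: "len (act (rot n r) c) = len c" if "r < n" "c \<in> D" for r c
  proof -
    have b: "fst c < snd c" "snd c < n" using nc_innerD[OF D(1) that(2)] n by auto
    consider "snd c + r < n" | "fst c + r < n" "\<not> snd c + r < n" | "\<not> fst c + r < n" "\<not> snd c + r < n"
      using b by linarith
    then show ?thesis by cases (use b that(1) in \<open>auto simp: len_def act_rot min_def\<close>)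
  qed
  have fin: "finite D" using nc_finite[OF finite_inner D(1)] .
  have "D \<noteq> {}" using D(3) n by auto
  then have "Max (len ` D) \<in> len ` D" using fin by (intro Max_in) auto
  then obtain c where c0: "c \<in> D" "Max (len ` D) = len c" by auto
  have c: "c \<in> D" "\<And>e. e \<in> D \<Longrightarrow> len e \<le> len c"
    using c0 Max_ge[OF finite_imageI[OF fin], of "len _" len] by auto
  \<comment> \<open>The starting point of the shorter arc, so that the rotation by \<open>u\<close>
    moves the chord to \<open>(0, len c)\<close>.\<close>
  define s where "s = (if 2 * (snd c - fst c) \<le> n then fst c else snd c)"
  have cb: "fst c + 2 \<le> snd c" "snd c < n" using nc_innerD[OF D(1) c(1)] n by auto
  define u where "u = (n - s) mod n"
  have un: "u < n" using n by (simp add: u_def)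
  have sn: "s < n" using cb by (simp add: s_def)
  have u: "u = (if s = 0 then 0 else n - s)" using sn by (simp add: u_def)
  have uc: "act (rot n u) c = (0, len c)"
    using cb un by (auto simp: act_rot u s_def len_def min_def split: if_splits)
  define D' where "D' = act (rot n u) ` D"
  have D': "D' \<in> nc (inner 0 (n - 1))" "card D' = n - 5"
    using bij_betw_act_nc[OF symmetry_rot[OF un]] card_act_image[OF symmetry_rot[OF un] D(1)] D
    by (auto simp: D'_def bij_betw_def)
  have inv': "act (rot n m) ` D' = D'"
  proof -
    have "act (rot n m) ` D' = act (rot n u) ` (act (rot n m) ` D)"
      unfolding D'_def image_image act_rot_rot by (simp add: add.commute)
    then show ?thesis using D(2) by (simp add: D'_def)
  qed
  have "len c = m"
  proof (rule longest_chord_fifth_turn[OF n D'(1) inv' D'(2)])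
    show "(0, len c) \<in> D'" using c(1) uc unfolding D'_def by force
    show "2 * len c \<le> n" using cb by (auto simp: len_def min_def)
    fix e assume "e \<in> D'"
    then obtain e' where "e' \<in> D" "e = act (rot n u) e'" by (auto simp: D'_def)
    then have "len e \<le> len c" using len_act[OF un] c(2) by simp
    then show "snd e - fst e \<le> len c \<or> n - (snd e - fst e) \<le> len c"
      by (auto simp: len_def[of e] min_def split: if_splits)
  qed
  define q where "q = s mod m"
  have q: "q < m" using n by (simp add: q_def)
  have cin: "c \<in> inner 0 (n - 1)" using c(1) D(1) by (auto simp: nc_def)
  have sc: "c = act (rot n s) (0, m)"
  proof -
    have "act (rot n s) (0, m) = act (rot n (s + u)) c"
      using uc \<open>len c = m\<close> by (metis act_rot_rot)
    also have "\<dots> = c" using act_rot_0[OF cin] sn by (simp add: u)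
    finally show ?thesis by simp
  qed
  have "act (rot n q) (0, m) = act (rot n (5 * m - (s div m) * m)) c"
  proof -
    have "s div m < 5" using sn n by (simp add: less_mult_imp_div_less)
    then have "s div m * m \<le> 5 * m" by simp
    then have "5 * m - (s div m) * m + s = q + n" unfolding q_def n(1)
      by (metis (no_types) Nat.add_diff_assoc2 add.commute add_diff_cancel_left' div_mult_mod_eq le_add_diff_inverse2 add.assoc)
    then have "rot n (5 * m - (s div m) * m + s) = rot n q"
      by (metis mod_add_self2 rot_mod)
    then show ?thesis unfolding sc act_rot_rot by simp
  qed
  also have "\<dots> \<in> D"
    using rot_invariant_mult[OF D(1,2), of "5 - s div m"] c(1) by (auto simp: diff_mult_distrib)
  finally have "act (rot n q) (0, m) \<in> D" .
  moreover have "act (rot n q) (0, m) = (q, q + m)" using q n by (simp add: act_rot)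
  ultimately show ?thesis using q by auto
qed

text \<open>From 5 + 5 |S| = n - 5 each sector has |S| = m - 2, so it is triangulated. For
  \<open>m = 1\<close> the central pentagon is the whole polygon and its sides are no chords, which
  puts this case outside the sector construction.\<close>

lemma card_fixed_fifth_turn:
  assumes n: "n = 5 * m" "m \<ge> 1"
  shows "card (fixed_dissections n (n - 5) (rot n m)) = m * num_closed 0 m"
proof (cases "m = 1")
  case True
  have "fixed_dissections n (n - 5) (rot n m) = {{}}"
    using True n nc_finite[OF finite_inner] by (auto simp: fixed_dissections_def nc_def)
  then show ?thesis using True by (simp add: num_closed_small)
next
  case False
  then have m: "m \<ge> 2" using n by simp
  have "card (fixed_dissections n (n - 5) (rot n m)) =
      m * card {D \<in> fixed_dissections n (n - 5) (rot n m). (0, m) \<in> D}"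
    by (rule card_fixed_by_unique_chord)
       (use n m ex_chord_fifth_turn[OF n(1) m] in \<open>auto simp: inner_def chords_def\<close>)
  moreover have "(5 + 5 * card S = n - 5) = (card S + 0 + 2 = m)" for S :: "(nat \<times> nat) set"
    using n m by linarith
  then have "card {D \<in> fixed_dissections n (n - 5) (rot n m). (0, m) \<in> D} = num_open 0 m"
    using card_fixed_with_base[OF n(1) _ m, of "n - 5"] by (simp add: num_open_def)
  ultimately show ?thesis using num_closed_eq_num_open(1)[OF m] by simp
qed

lemma sum_card_fixed_rot:
  assumes n: "n \<ge> 5"
  shows "(\<Sum>r<n. card (fixed_dissections n (n - 5) (rot n r))) =
    num_open 2 (n - 1) + (if even n then n div 2 * num_open 1 (n div 2) else 0) +
    (if 5 dvd n then 4 * (n div 5 * num_closed 0 (n div 5)) else 0)"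
proof -
  let ?f = "\<lambda>r. card (fixed_dissections n (n - 5) (rot n r))"
  define m where "m = n div 5"
  define X where "X = (if even n then {n div 2} else {})"
  define Y where "Y = (if 5 dvd n then {m, 2 * m, 3 * m, 4 * m} else {})"
  have zero: "?f r = 0" if r: "0 < r" "r < n" "r \<notin> X" "r \<notin> Y" for r
  proof -
    have "fixed_dissections n (n - 5) (rot n r) = {}"
    proof (rule ccontr)
      assume "fixed_dissections n (n - 5) (rot n r) \<noteq> {}"
      then consider "2 * r = n" | "n = 5 * gcd r n" using rotation_orders[OF n r(1,2)] by blast
      then show False
      proof cases
        case 1
        then show False using r(3) by (auto simp: X_def split: if_splits)
      next
        case 2
        then have m5: "5 dvd n" "m = gcd r n" unfolding m_def by (metis dvd_triv_left, simp)
        obtain q where q: "r = m * q" unfolding m5(2) by (metis dvdE gcd_dvd1)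
        have "n = 5 * m" using 2 m5(2) by simp
        then have "q < 5" "0 < q" using q r(1,2) by (simp_all add: mult.commute)
        then have "q = 1 \<or> q = 2 \<or> q = 3 \<or> q = 4" by linarith
        then show False using r(4) q m5(1) by (auto simp: Y_def)
      qed
    qed
    then show ?thesis by simp
  qed
  have f0: "?f 0 = num_open 2 (n - 1)"
  proof -
    \<comment> \<open>All dissections count here: on the vertices 0 to n - 1 the maximum is n - 3,
      so the shortfall is 2.\<close>
    have "fixed_dissections n (n - 5) (rot n 0) = {D \<in> nc (inner 0 (n - 1)). card D + 2 + 2 = n - 1}"
      using n act_rot_image_0 by (auto simp: fixed_dissections_def)
    then show ?thesis by (simp add: num_open_def)
  qed
  have fX: "sum ?f X = (if even n then n div 2 * num_open 1 (n div 2) else 0)"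
    using card_fixed_half_turn[of n "n div 2"] n by (auto simp: X_def)
  have fY: "sum ?f Y = (if 5 dvd n then 4 * (m * num_closed 0 m) else 0)"
  proof (cases "5 dvd n")
    case True
    then have nm: "n = 5 * m" "m \<ge> 1" using n by (auto simp: m_def)
    \<comment> \<open>For \<open>q\<close> prime to 5 the gcd of \<open>q * m\<close> and
      \<open>5 * m\<close> is \<open>m\<close>, so the four rotations generate one group and fix the
      same dissections.\<close>
    have "?f (q * m) = m * num_closed 0 m" if q: "q > 0" "coprime q 5" for q
    proof -
      have g: "gcd (q * m) n = m"
        using q unfolding nm(1) by (simp add: gcd_mult_distrib_nat[symmetric] mult.commute coprime_iff_gcd_eq_1)
      have "fixed_dissections n (n - 5) (rot n (q * m)) = fixed_dissections n (n - 5) (rot n m)"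
        using rot_invariant_gcd[of _ n "q * m"] g q nm by (auto simp: fixed_dissections_def)
      then show ?thesis using card_fixed_fifth_turn[OF nm] by simp
    qed
    note q = this
    have "coprime 2 (5::nat)" "coprime 3 (5::nat)" "coprime 4 (5::nat)"
      by (simp_all add: coprime_iff_gcd_eq_1 gcd_non_0_nat)
    then have "?f m = m * num_closed 0 m" "?f (2 * m) = m * num_closed 0 m"
      "?f (3 * m) = m * num_closed 0 m" "?f (4 * m) = m * num_closed 0 m"
      using q[of 1] q[of 2] q[of 3] q[of 4] by simp_all
    then show ?thesis using True nm by (simp add: Y_def)
  qed (simp add: Y_def)
  have XY: "X \<inter> Y = {}"
  proof -
    have False if "even n" "5 dvd n" "n div 2 \<in> {m, 2 * m, 3 * m, 4 * m}"
    proof -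
      have "n = 5 * m" "n = 2 * (n div 2)" using that by (auto simp: m_def)
      then show False using that(3) n by auto
    qed
    then show ?thesis by (auto simp: X_def Y_def)
  qed
  have sub: "insert 0 (X \<union> Y) \<subseteq> {..<n}" "0 \<notin> X \<union> Y"
    using n by (auto simp: X_def Y_def m_def)
  have "sum ?f {..<n} = sum ?f (insert 0 (X \<union> Y))"
    by (rule sum.mono_neutral_right) (use sub zero in auto)
  also have "\<dots> = ?f 0 + (sum ?f X + sum ?f Y)"
    using sub(2) XY by (subst sum.insert) (auto simp: X_def Y_def sum.union_disjoint)
  finally show ?thesis using f0 fX fY by (simp add: m_def)
qed

section \<open>Dissections fixed by a reflection\<close>

text \<open>Conjugating i \<mapsto> r - i by the rotation by \<open>t\<close> gives i \<mapsto> r +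
  2t - i.\<close>

lemma card_fixed_flip_conj:
  assumes "r < n" "s < n" "t < n" "r + 2 * t = s \<or> r + 2 * t = s + n"
  shows "card (fixed_dissections n k (flip n r)) = card (fixed_dissections n k (flip n s))"
proof -
  have "flip n s (rot n t i) = rot n t (flip n r i)" if "i < n" for i
    using assms that by (auto simp: rot_if flip_if split: if_splits)
  then show ?thesis
    using card_fixed_conj[OF symmetry_rot[OF assms(3)] symmetry_flip[OF assms(1)],
        of "flip n s" "\<lambda>_. True" "\<lambda>_. True" k] by simp
qed

text \<open>The vertices \<open>0, \<dots>, H\<close> lie on one side of the axis of \<open>i \<mapsto> N - i\<close>, where \<open>N = n\<close> stands for
  the reflection fixing the vertex \<open>0\<close>. Chords perpendicular to the axis become chords to the
  additional vertex \<open>H + 1\<close>.\<close>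

context
  fixes n N H :: nat
  assumes n: "n \<ge> 5" and N: "N = n - 1 \<or> N = n \<and> even n" and H: "H = N div 2"
begin

definition mirror :: "nat \<times> nat \<Rightarrow> nat \<times> nat" where
  "mirror c = act (flip n (N mod n)) c"

definition unfold_mirror :: "(nat \<times> nat) set \<Rightarrow> (nat \<times> nat) set" where
  "unfold_mirror E = {c \<in> E. snd c \<le> H} \<union> mirror ` {c \<in> E. snd c \<le> H} \<union> {(i, N - i) | i. (i, Suc H) \<in> E}"

text \<open>For \<open>i = 0\<close> the pair \<open>(i, N - i)\<close> is a side or ends at the
  non-vertex \<open>n\<close>; for \<open>i = H\<close> its ends coincide or are adjacent. The
  bounds keep the perpendicular chords proper.\<close>

definition fold_mirror :: "(nat \<times> nat) set \<Rightarrow> (nat \<times> nat) set" where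
  "fold_mirror D = {c \<in> D. snd c \<le> H} \<union> {(i, Suc H) | i. 0 < i \<and> i < H \<and> (i, N - i) \<in> D}"

lemma NH: "2 * H \<le> N" "N \<le> 2 * H + 1" "N \<le> n" "n \<le> N + 1" "N = n \<Longrightarrow> N = 2 * H" "H \<ge> 2" "Suc H < n"
  using n N H by auto

lemma symmetry_mirror: "symmetry n (flip n (N mod n))"
  using n by (intro symmetry_flip) simp

lemma mirror_eq:
  assumes "fst c < snd c" "snd c < n"
  shows "mirror c = (if N = n \<and> fst c = 0 then (0, n - snd c) else (N - snd c, N - fst c))"
proof -
  have r: "N mod n = (if N = n then 0 else n - 1)" "N mod n < n" using N n by auto
  show ?thesis unfolding mirror_def act_flip[OF assms r(2)] using r(1) N n assms by auto
qed

lemma mirror_inner: "c \<in> inner 0 (n - 1) \<Longrightarrow> mirror c \<in> inner 0 (n - 1)"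
  using symmetry_mirror unfolding symmetry_def mirror_def by blast

lemma mirror_crosses:
  "c \<in> inner 0 (n - 1) \<Longrightarrow> e \<in> inner 0 (n - 1) \<Longrightarrow> crosses (mirror c) (mirror e) \<longleftrightarrow> crosses c e"
  using symmetry_mirror unfolding symmetry_def mirror_def by blast

lemma mirror_mirror:
  assumes "c \<in> inner 0 (n - 1)"
  shows "mirror (mirror c) = c"
proof -
  have c: "fst c < snd c" "snd c < n" using innerD[OF assms] by auto
  have m: "fst (mirror c) < snd (mirror c)" "snd (mirror c) < n"
    using innerD[OF mirror_inner[OF assms]] by auto
  show ?thesis
    using m c NH(3,4) unfolding mirror_eq[OF m] unfolding mirror_eq[OF c]
    by (auto simp: prod_eq_iff)
qed

lemma half_subset: "chords 0 H \<subseteq> inner 0 (n - 1)"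
  using NH(6,7) by (auto simp: inner_def chords_def)

lemma inner_Suc_half: "c \<in> inner 0 (Suc H) \<Longrightarrow> snd c \<le> H \<Longrightarrow> c \<in> chords 0 H"
  by (auto simp: inner_def chords_def)

lemma perp_inner:
  assumes "(i, Suc H) \<in> inner 0 (Suc H)"
  shows "0 < i" "i < H" "(i, N - i) \<in> inner 0 (n - 1)" "mirror (i, N - i) = (i, N - i)"
proof -
  show i: "0 < i" "i < H" using assms by (auto simp: inner_def chords_def)
  show "(i, N - i) \<in> inner 0 (n - 1)"
    using i NH by (auto simp: inner_def chords_def)
  show "mirror (i, N - i) = (i, N - i)" using i NH by (subst mirror_eq) auto
qed

text \<open>The second alternative arises because the axis for \<open>N = n\<close> passes through
  vertex 0: a chord starting there keeps that end.\<close>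

lemma mirror_half:
  assumes "c \<in> chords 0 H"
  shows "N - H \<le> fst (mirror c) \<and> snd (mirror c) = N - fst c \<or>
    N = n \<and> fst c = 0 \<and> fst (mirror c) = 0 \<and> snd (mirror c) = N - snd c"
proof -
  have "fst c < snd c" "snd c < n" "snd c \<le> H" using assms NH(7) by (auto simp: chords_def)
  then show ?thesis using mirror_eq[of c] by auto
qed

lemma unfold_mirror_nc:
  assumes E: "E \<in> nc (inner 0 (Suc H))"
  shows "unfold_mirror E \<in> nc (inner 0 (n - 1))" "mirror ` unfold_mirror E = unfold_mirror E"
proof -
  define S where "S = {c \<in> E. snd c \<le> H}"
  define P where "P = {(i, N - i) | i. (i, Suc H) \<in> E}"
  have U: "unfold_mirror E = S \<union> mirror ` S \<union> P" by (simp add: unfold_mirror_def S_def P_def)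
  have Es: "E \<subseteq> inner 0 (Suc H)" using E by (simp add: nc_def)
  have S: "S \<subseteq> chords 0 H" using Es inner_Suc_half by (auto simp: S_def)
  have Si: "S \<subseteq> inner 0 (n - 1)" using S half_subset by blast
  have Pi: "p \<in> inner 0 (n - 1)" "mirror p = p" if "p \<in> P" for p
    using that Es perp_inner by (auto simp: P_def)
  have sub: "unfold_mirror E \<subseteq> inner 0 (n - 1)"
    unfolding U using Si Pi mirror_inner by auto
  have sym: "crosses x y \<longleftrightarrow> crosses y x" for x y by (auto simp: crosses_def)
  have SS: "\<not> crosses c e" if "c \<in> S" "e \<in> S" for c e
    using nc_not_crosses[OF E] that by (simp add: S_def)
  have SM: "\<not> crosses c (mirror e)" if "c \<in> S" "e \<in> S" for c e
  proof -
    have "c \<in> chords 0 H" "e \<in> chords 0 H" using that S by auto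
    then show ?thesis using mirror_half[of e] NH(1,5) by (auto simp: crosses_def chords_def)
  qed
  \<comment> \<open>For \<open>i < H\<close> both \<open>N - i\<close> and \<open>Suc H\<close> lie
    beyond \<open>H\<close>, so a chord of the half cannot distinguish them: it crosses
    \<open>(i, N - i)\<close> exactly if it crosses \<open>(i, Suc H)\<close>.\<close>
  have SP: "\<not> crosses c p" if c: "c \<in> S" "p \<in> P" for c p
  proof -
    obtain i where i: "p = (i, N - i)" "(i, Suc H) \<in> E" using c(2) by (auto simp: P_def)
    have "0 < i" "i < H" using perp_inner i Es by auto
    moreover have "\<not> crosses c (i, Suc H)" "snd c \<le> H"
      using nc_not_crosses[OF E _ i(2)] c by (auto simp: S_def)
    ultimately show ?thesis using i NH(1) by (auto simp: crosses_def)
  qed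
  have PP: "\<not> crosses p q" if "p \<in> P" "q \<in> P" for p q
    using that by (auto simp: P_def crosses_def)
  have MM: "\<not> crosses (mirror c) (mirror e)" if "c \<in> S" "e \<in> S" for c e
    using SS[OF that] mirror_crosses[of c e] that Si by blast
  have MP: "\<not> crosses (mirror c) p" if "c \<in> S" "p \<in> P" for c p
    using SP[OF that] mirror_crosses[of c p] that Si Pi by (metis subsetD)
  have "\<not> crosses c e" if "c \<in> S \<union> mirror ` S \<union> P" "e \<in> S \<union> mirror ` S \<union> P" for c e
    using that SS SM SP PP MM MP sym by (elim UnE imageE) blast+
  then show nc: "unfold_mirror E \<in> nc (inner 0 (n - 1))"
    using sub unfolding nc_def U by blast
  have "mirror ` unfold_mirror E \<subseteq> unfold_mirror E"
    unfolding U using mirror_mirror Si Pi(2) by auto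
  then show "mirror ` unfold_mirror E = unfold_mirror E"
    using invariantI[OF symmetry_mirror nc] by (simp add: mirror_def)
qed

lemma fold_unfold_mirror:
  assumes E: "E \<in> nc (inner 0 (Suc H))"
  shows "fold_mirror (unfold_mirror E) = E"
proof -
  have Es: "E \<subseteq> inner 0 (Suc H)" using E by (simp add: nc_def)
  have m: "mirror c \<in> E" if c: "c \<in> E" "snd c \<le> H" "snd (mirror c) \<le> H" for c
  proof -
    have cH: "c \<in> chords 0 H" using c Es inner_Suc_half by blast
    then have "fst c + 2 \<le> snd c" by (auto simp: chords_def)
    then have "mirror c = c" using mirror_half[OF cH] c(2,3) NH by (auto simp: prod_eq_iff)
    then show ?thesis using c by simp
  qed
  have a: "{c \<in> unfold_mirror E. snd c \<le> H} = {c \<in> E. snd c \<le> H}"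
  proof -
    have "\<not> N - i \<le> H" if "(i, Suc H) \<in> E" for i
      using perp_inner(2) that Es NH(1) by fastforce
    then show ?thesis using m unfolding unfold_mirror_def by auto
  qed
  have b: "(i, N - i) \<in> unfold_mirror E \<longleftrightarrow> (i, Suc H) \<in> E" if i: "0 < i" "i < H" for i
  proof
    assume "(i, N - i) \<in> unfold_mirror E"
    moreover have "\<not> N - i \<le> H" using i NH(1) by simp
    moreover have "mirror c \<noteq> (i, N - i)" if "c \<in> E" "snd c \<le> H" for c
    proof -
      have "c \<in> chords 0 H" using that Es inner_Suc_half by blast
      then show ?thesis using mirror_half[of c] i NH(1) by auto
    qed
    ultimately show "(i, Suc H) \<in> E" using i NH(1) by (force simp: unfold_mirror_def)
  qed (auto simp: unfold_mirror_def)
  have "{(i, Suc H) | i. 0 < i \<and> i < H \<and> (i, N - i) \<in> unfold_mirror E} = {c \<in> E. \<not> snd c \<le> H}"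
  proof (intro equalityI subsetI)
    fix c assume c: "c \<in> {c \<in> E. \<not> snd c \<le> H}"
    then have "c = (fst c, Suc H)" "0 < fst c" "fst c < H"
      using nc_innerD[OF E, of c] by (auto simp: prod_eq_iff)
    moreover from this have "(fst c, N - fst c) \<in> unfold_mirror E" using b c by auto
    ultimately show "c \<in> {(i, Suc H) | i. 0 < i \<and> i < H \<and> (i, N - i) \<in> unfold_mirror E}" by blast
  qed (use b in auto)
  then show ?thesis unfolding fold_mirror_def a by auto
qed

text \<open>A chord such that neither it nor its image lies within 0 to \<open>H\<close> joins the
  two sides of the axis; it crosses its image unless it is perpendicular to the axis.\<close>

lemma mirror_trichotomy:
  assumes D: "D \<in> nc (inner 0 (n - 1))" and inv: "mirror ` D = D" and c: "c \<in> D" "snd c > H"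
  shows "snd (mirror c) \<le> H \<or> snd c = N - fst c \<and> 0 < fst c \<and> fst c < H"
proof (rule ccontr)
  assume *: "\<not> ?thesis"
  have ci: "c \<in> inner 0 (n - 1)" using D c by (auto simp: nc_def)
  then have b: "fst c + 2 \<le> snd c" "snd c < n" "c \<noteq> (0, n - 1)" using innerD[OF ci] by (auto simp: inner_def)
  have "mirror c \<in> D" using inv c by blast
  then have ncr: "\<not> crosses c (mirror c)" using nc_not_crosses[OF D c(1)] by blast
  show False
  proof (cases "N = n \<and> fst c = 0")
    case True
    then show False using * b NH mirror_eq[of c] c(2) by auto
  next
    case False
    then have m: "mirror c = (N - snd c, N - fst c)" using mirror_eq[of c] b by auto
    have i: "N - fst c > H" using * m by auto
    have "snd c \<noteq> N - fst c"
    proof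
      assume eq: "snd c = N - fst c"
      have "fst c < H" using eq b i NH(1,2) by linarith
      moreover have "fst c \<noteq> 0" using eq b(2,3) N n by (auto simp: prod_eq_iff)
      ultimately show False using * eq by simp
    qed
    then show False using ncr m b i NH(1-4) c(2) by (auto simp: crosses_def)
  qed
qed

lemma unfold_fold_mirror:
  assumes D: "D \<in> nc (inner 0 (n - 1))" and inv: "mirror ` D = D"
  shows "fold_mirror D \<in> nc (inner 0 (Suc H))" "unfold_mirror (fold_mirror D) = D"
proof -
  have Ds: "D \<subseteq> inner 0 (n - 1)" using D by (simp add: nc_def)
  have half: "c \<in> chords 0 H" if "c \<in> D" "snd c \<le> H" for c
    using Ds that by (auto simp: inner_def chords_def)
  let ?P = "{(i, Suc H) | i. 0 < i \<and> i < H \<and> (i, N - i) \<in> D}"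
  have sym: "crosses x y \<longleftrightarrow> crosses y x" for x y by (auto simp: crosses_def)
  have SP: "\<not> crosses c p" if c: "c \<in> D" "snd c \<le> H" "p \<in> ?P" for c p
  proof -
    obtain i where i: "p = (i, Suc H)" "0 < i" "i < H" "(i, N - i) \<in> D" using c(3) by auto
    then have "\<not> crosses c (i, N - i)" using nc_not_crosses[OF D c(1)] by blast
    then show ?thesis using i c(2) NH(1) by (auto simp: crosses_def)
  qed
  show "fold_mirror D \<in> nc (inner 0 (Suc H))"
    unfolding nc_def
  proof (intro CollectI conjI ballI)
    show "fold_mirror D \<subseteq> inner 0 (Suc H)"
      using half by (auto simp: fold_mirror_def inner_def chords_def)
    fix c e assume ce: "c \<in> fold_mirror D" "e \<in> fold_mirror D"
    have PP: "\<not> crosses p q" if "p \<in> ?P" "q \<in> ?P" for p q using that by (auto simp: crosses_def)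
    show "\<not> crosses c e"
      using ce nc_not_crosses[OF D] SP PP sym unfolding fold_mirror_def by blast
  qed
  have S: "{c \<in> fold_mirror D. snd c \<le> H} = {c \<in> D. snd c \<le> H}" by (auto simp: fold_mirror_def)
  have P: "{(i, N - i) | i. (i, Suc H) \<in> fold_mirror D} = {(i, N - i) | i. 0 < i \<and> i < H \<and> (i, N - i) \<in> D}"
    by (auto simp: fold_mirror_def)
  show "unfold_mirror (fold_mirror D) = D"
    unfolding unfold_mirror_def S P
  proof (intro equalityI subsetI)
    fix c assume "c \<in> {c \<in> D. snd c \<le> H} \<union> mirror ` {c \<in> D. snd c \<le> H} \<union> {(i, N - i) | i. 0 < i \<and> i < H \<and> (i, N - i) \<in> D}"
    then show "c \<in> D" using inv by blast
  next
    fix c assume c: "c \<in> D"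
    consider "snd c \<le> H" | "snd (mirror c) \<le> H" | "snd c = N - fst c" "0 < fst c" "fst c < H"
      using mirror_trichotomy[OF D inv c] by linarith
    then show "c \<in> {c \<in> D. snd c \<le> H} \<union> mirror ` {c \<in> D. snd c \<le> H} \<union> {(i, N - i) | i. 0 < i \<and> i < H \<and> (i, N - i) \<in> D}"
    proof cases
      case 2
      have "mirror c \<in> {c \<in> D. snd c \<le> H}" using inv c 2 by blast
      moreover have "c = mirror (mirror c)" using mirror_mirror[of c] c Ds by auto
      ultimately show ?thesis by blast
    next
      case 3
      then have ceq: "c = (fst c, N - fst c)" by (simp add: prod_eq_iff)
      then have "(fst c, N - fst c) \<in> D" using c by simp
      then show ?thesis using 3 ceq by blast
    qed (use c in auto)
  qed
qed

text \<open>Every chord of \<open>E\<close> yields two diagonals, except for two kinds that yield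
  one: the chords to the additional vertex and, for \<open>N = n\<close>, the chord
  \<open>(0, H)\<close>, which lies on the axis.\<close>

lemma card_unfold_mirror:
  assumes E: "E \<in> nc (inner 0 (Suc H))"
  shows "card (unfold_mirror E) + card (ending_at (Suc H) E) + (if N = n \<and> (0, H) \<in> E then 1 else 0) = 2 * card E"
proof -
  define S where "S = {c \<in> E. snd c \<le> H}"
  define P where "P = {(i, N - i) | i. (i, Suc H) \<in> E}"
  have Es: "E \<subseteq> inner 0 (Suc H)" using E by (simp add: nc_def)
  have fin: "finite E" "finite S" using nc_finite[OF finite_inner E] by (auto simp: S_def)
  have S: "c \<in> chords 0 H" if "c \<in> S" for c
    using that Es inner_Suc_half[of c] by (auto simp: S_def)
  have P: "P = (\<lambda>c. (fst c, N - fst c)) ` ending_at (Suc H) E"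
    unfolding P_def ending_at_def by force
  have cP: "card P = card (ending_at (Suc H) E)"
    unfolding P by (rule card_image) (auto simp: inj_on_def ending_at_def)
  have cM: "card (mirror ` S) = card S"
  proof (rule card_image)
    show "inj_on mirror S"
      using S half_subset mirror_mirror by (metis inj_on_inverseI subsetD)
  qed
  have cE: "card E = card S + card (ending_at (Suc H) E)"
  proof -
    have "E = S \<union> ending_at (Suc H) E"
      using Es by (auto simp: S_def ending_at_def inner_def chords_def)
    moreover have "S \<inter> ending_at (Suc H) E = {}" by (auto simp: S_def ending_at_def)
    ultimately show ?thesis using card_Un_disjoint[of S "ending_at (Suc H) E"] fin
      by (auto simp: ending_at_def)
  qed
  have i: "i < H" if "(i, Suc H) \<in> E" for i using that Es perp_inner by auto
  have dP: "(S \<union> mirror ` S) \<inter> P = {}"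
  proof -
    have "c \<noteq> (i, N - i) \<and> mirror c \<noteq> (i, N - i)" if "c \<in> S" "(i, Suc H) \<in> E" for c i
    proof -
      have "0 < i" using perp_inner that(2) Es by auto
      then show ?thesis
        using mirror_half[OF S[OF that(1)]] S[OF that(1)] i[OF that(2)] NH(1) by (auto simp: chords_def)
    qed
    then show ?thesis by (fastforce simp: P_def)
  qed
  have dM: "S \<inter> mirror ` S = (if N = n \<and> (0, H) \<in> E then {(0, H)} else {})"
  proof -
    have "N = n \<and> c = (0, H) \<and> mirror c = (0, H)" if "c \<in> S" "mirror c \<in> S" for c
      using mirror_half[OF S[OF that(1)]] S[OF that(1)] S[OF that(2)] NH(1,5) by (auto simp: chords_def prod_eq_iff)
    moreover have "mirror (0, H) = (0, H)" if "N = n"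
      using that mirror_eq[of "(0, H)"] NH by auto
    moreover have "(0, H) \<in> S" if "(0, H) \<in> E" using that by (simp add: S_def)
    ultimately show ?thesis by (force simp: S_def)
  qed
  have "card (S \<union> mirror ` S) + card (S \<inter> mirror ` S) = card S + card (mirror ` S)"
    using card_Un_Int[of S "mirror ` S"] fin by simp
  moreover have "card (unfold_mirror E) = card (S \<union> mirror ` S) + card P"
    unfolding unfold_mirror_def S_def[symmetric] P_def[symmetric]
    by (rule card_Un_disjoint) (use fin dP P in \<open>auto simp: ending_at_def\<close>)
  ultimately show ?thesis using cM cP cE unfolding dM by (auto split: if_splits)
qed

lemma card_fixed_mirror:
  "card (fixed_dissections n k (flip n (N mod n))) =
   card {E \<in> nc (inner 0 (Suc H)).
     k + card (ending_at (Suc H) E) + (if N = n \<and> (0, H) \<in> E then 1 else 0) = 2 * card E}"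
proof -
  have bij: "bij_betw unfold_mirror (nc (inner 0 (Suc H))) {D \<in> nc (inner 0 (n - 1)). mirror ` D = D}"
  proof (rule bij_betw_byWitness[where f' = fold_mirror])
    show "unfold_mirror ` nc (inner 0 (Suc H)) \<subseteq> {D \<in> nc (inner 0 (n - 1)). mirror ` D = D}"
      using unfold_mirror_nc by blast
  qed (use fold_unfold_mirror unfold_fold_mirror in blast)+
  have "fixed_dissections n k (flip n (N mod n)) =
     {D \<in> {D \<in> nc (inner 0 (n - 1)). mirror ` D = D}. card D = k}"
    by (auto simp: fixed_dissections_def mirror_def)
  then have "card (fixed_dissections n k (flip n (N mod n))) =
     card {D \<in> {D \<in> nc (inner 0 (n - 1)). mirror ` D = D}. card D = k}" by simp
  also have "\<dots> = card {E \<in> nc (inner 0 (Suc H)).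
     k + card (ending_at (Suc H) E) + (if N = n \<and> (0, H) \<in> E then 1 else 0) = 2 * card E}"
  proof (rule bij_betw_card_filter[OF bij, symmetric])
    fix E assume "E \<in> nc (inner 0 (Suc H))"
    from card_unfold_mirror[OF this]
    show "card (unfold_mirror E) = k \<longleftrightarrow>
      k + card (ending_at (Suc H) E) + (if N = n \<and> (0, H) \<in> E then 1 else 0) = 2 * card E" by linarith
  qed
  finally show ?thesis .
qed

end

section \<open>The size equation for each kind of axis\<close>

lemma card_split:
  assumes "finite X" "\<And>x. x \<in> X \<Longrightarrow> P x \<longleftrightarrow> Q x \<or> R x" "\<And>x. x \<in> X \<Longrightarrow> \<not> (Q x \<and> R x)"
  shows "card {x \<in> X. P x} = card {x \<in> X. Q x} + card {x \<in> X. R x}"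
proof -
  have "{x \<in> X. P x} = {x \<in> X. Q x} \<union> {x \<in> X. R x}" using assms(2) by blast
  then show ?thesis using assms by (simp add: card_Un_disjoint disjoint_iff)
qed

text \<open>With \<open>p\<close> chords at \<open>Suc h\<close> and |E| = h - 1 - \<delta>, the
  size equation becomes p + 2\<delta> = 2, with solutions (p, \<delta>) = (0, 1) and (2, 0).\<close>

lemma card_fixed_flip_odd:
  assumes n: "n = 2 * h + 1" "h \<ge> 2"
  shows "card (fixed_dissections n (n - 5) (flip n (n - 1))) = num_closed 1 h + num_fan 2 0 (Suc h)"
proof -
  have "card (fixed_dissections n (n - 5) (flip n ((n - 1) mod n))) =
     card {E \<in> nc (inner 0 (Suc h)). n - 5 + card (ending_at (Suc h) E) = 2 * card E}"
  proof -
    have pre: "n \<ge> 5" "n - 1 = n - 1 \<or> n - 1 = n \<and> even n" "h = (n - 1) div 2" "n - 1 \<noteq> n"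
      using n by auto
    show ?thesis unfolding card_fixed_mirror[OF pre(1-3)] using pre(4) by (simp only: simp_thms if_False add_0_right)
  qed
  also have "\<dots> = num_fan 0 1 (Suc h) + num_fan 2 0 (Suc h)"
    unfolding num_fan_def
  proof (rule card_split)
    fix E assume "E \<in> nc (inner 0 (Suc h))"
    then have "card E + 2 \<le> Suc h" using card_nc_inner[of 0 "Suc h" E] n by simp
    then show "n - 5 + card (ending_at (Suc h) E) = 2 * card E \<longleftrightarrow>
      (card (ending_at (Suc h) E) = 0 \<and> card E + 1 + 2 = Suc h) \<or>
      (card (ending_at (Suc h) E) = 2 \<and> card E + 0 + 2 = Suc h)"
      using n by presburger
  qed (auto simp: finite_nc)
  finally show ?thesis using n by (simp add: num_fan_0)
qed

text \<open>The axis passes through two sides, so the half has one vertex less and the size equation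
  is p + 2\<delta> = 1, leaving only p = 1 and \<delta> = 0.\<close>

lemma card_fixed_flip_even_edges:
  assumes n: "n = 2 * h" "h \<ge> 3"
  shows "card (fixed_dissections n (n - 5) (flip n (n - 1))) = num_fan 1 0 h"
proof -
  obtain l where h: "h = Suc l" "l \<ge> 2" using n by (cases h) auto
  have "card (fixed_dissections n (n - 5) (flip n ((n - 1) mod n))) =
     card {E \<in> nc (inner 0 (Suc l)). n - 5 + card (ending_at (Suc l) E) = 2 * card E}"
  proof -
    have pre: "n \<ge> 5" "n - 1 = n - 1 \<or> n - 1 = n \<and> even n" "l = (n - 1) div 2" "n - 1 \<noteq> n"
      using n h by auto
    show ?thesis unfolding card_fixed_mirror[OF pre(1-3)] using pre(4) by (simp only: simp_thms if_False add_0_right)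
  qed
  also have "\<dots> = num_fan 1 0 (Suc l)"
    unfolding num_fan_def
  proof (intro arg_cong[where f = card] Collect_cong conj_cong refl)
    fix E assume "E \<in> nc (inner 0 (Suc l))"
    then have "card E + 2 \<le> Suc l" using card_nc_inner[of 0 "Suc l" E] h by simp
    then show "n - 5 + card (ending_at (Suc l) E) = 2 * card E \<longleftrightarrow>
      (card (ending_at (Suc l) E) = 1 \<and> card E + 0 + 2 = Suc l)"
      using n h by presburger
  qed
  finally show ?thesis using n h by simp
qed

text \<open>Let a = 1 if the diameter \<open>(0, h)\<close> on the axis is present and a = 0
  otherwise; the size equation is p + a + 2\<delta> = 3. The diameter crosses all perpendicular
  chords, so a = 1 forces p = 0 and \<delta> = 1; for a = 0 the pairs (p, \<delta>) = (1, 1) and (3,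
  0) remain.\<close>

lemma card_fixed_flip_even_vertices:
  assumes n: "n = 2 * h" "h \<ge> 3"
  shows "card (fixed_dissections n (n - 5) (flip n 0)) =
    num_open 1 h + num_fan 1 1 (Suc h) + num_fan 3 0 (Suc h)"
proof -
  let ?p = "\<lambda>E. card (ending_at (Suc h) E)"
  have "card (fixed_dissections n (n - 5) (flip n (n mod n))) =
     card {E \<in> nc (inner 0 (Suc h)). n - 5 + ?p E + (if (0, h) \<in> E then 1 else 0) = 2 * card E}"
  proof -
    have pre: "n \<ge> 5" "n = n - 1 \<or> n = n \<and> even n" "h = n div 2" using n by auto
    show ?thesis unfolding card_fixed_mirror[OF pre] by (simp only: simp_thms)
  qed
  also have "\<dots> = card {E \<in> nc (inner 0 (Suc h)). ?p E = 0 \<and> card E + 1 + 1 = h \<and> (0, h) \<in> E} +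
     card {E \<in> nc (inner 0 (Suc h)). ?p E = 1 \<and> card E + 1 + 2 = Suc h \<or> ?p E = 3 \<and> card E + 0 + 2 = Suc h}"
  proof (rule card_split)
    fix E assume E: "E \<in> nc (inner 0 (Suc h))"
    then have "card E + 2 \<le> Suc h" using card_nc_inner[of 0 "Suc h" E] n by simp
    moreover have "?p E = 0" if b: "(0, h) \<in> E"
    proof -
      have "c \<notin> E" if "snd c = Suc h" for c
        using nc_not_crosses[OF E b, of c] nc_innerD[OF E, of c] that by (auto simp: crosses_def prod_eq_iff)
      then have "ending_at (Suc h) E = {}" by (auto simp: ending_at_def)
      then show ?thesis by simp
    qed
    ultimately show "n - 5 + ?p E + (if (0, h) \<in> E then 1 else 0) = 2 * card E \<longleftrightarrow>
      (?p E = 0 \<and> card E + 1 + 1 = h \<and> (0, h) \<in> E) \<or>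
      (?p E = 1 \<and> card E + 1 + 2 = Suc h \<or> ?p E = 3 \<and> card E + 0 + 2 = Suc h)"
      using n by (cases "(0, h) \<in> E") (simp_all, presburger+)
  qed (auto simp: finite_nc)
  also have "card {E \<in> nc (inner 0 (Suc h)). ?p E = 1 \<and> card E + 1 + 2 = Suc h \<or> ?p E = 3 \<and> card E + 0 + 2 = Suc h}
     = num_fan 1 1 (Suc h) + num_fan 3 0 (Suc h)"
    unfolding num_fan_def by (rule card_split) (auto simp: finite_nc)
  also have "{E \<in> nc (inner 0 (Suc h)). ?p E = 0 \<and> card E + 1 + 1 = h \<and> (0, h) \<in> E}
     = {E \<in> nc (chords 0 h). card E + 1 + 1 = h \<and> (0, h) \<in> E}"
  proof -
    have e1: "?p E = 0 \<longleftrightarrow> ending_at (Suc h) E = {}" if "E \<in> nc (inner 0 (Suc h))" for E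
      using nc_finite[OF finite_inner that] by (simp add: ending_at_def)
    have e2: "{E \<in> nc (inner 0 (Suc h)). ending_at (Suc h) E = {}} = nc (chords 0 h)"
      using nc_inner_ending_empty[of 0 "Suc h"] n by simp
    show ?thesis unfolding e2[symmetric] mem_Collect_eq conj_assoc
      by (intro Collect_cong conj_cong refl) (auto simp only: e1)
  qed
  finally show ?thesis using num_open_eq_card_with_base[of h 1] n by simp
qed

text \<open>As 2 is invertible modulo an odd \<open>n\<close>, all reflections are conjugate by
  rotations.\<close>

lemma sum_card_fixed_flip_odd:
  assumes n: "n = 2 * h + 1" "h \<ge> 2"
  shows "(\<Sum>r<n. card (fixed_dissections n (n - 5) (flip n r))) =
    n * (num_closed 1 h + num_fan 2 0 (Suc h))"
proof -
  have "card (fixed_dissections n (n - 5) (flip n r)) = num_closed 1 h + num_fan 2 0 (Suc h)" if r: "r < n" for r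
  proof -
    have "\<exists>t<n. r + 2 * t = n - 1 \<or> r + 2 * t = n - 1 + n"
    proof (cases "even r")
      case True
      then obtain q where "r = 2 * q" by blast
      then show ?thesis using n r by (intro exI[of _ "h - q"]) auto
    next
      case False
      then obtain q where "r = 2 * q + 1" by (rule oddE)
      then show ?thesis using n r by (intro exI[of _ "2 * h - q"]) auto
    qed
    then obtain t where "t < n" "r + 2 * t = n - 1 \<or> r + 2 * t = n - 1 + n" by blast
    then show ?thesis
      using card_fixed_flip_conj[OF r, of "n - 1" t "n - 5"] card_fixed_flip_odd[OF n] n by simp
  qed
  then show ?thesis by simp
qed

text \<open>Conjugation by rotations preserves the parity of \<open>r\<close>, which gives two
  classes of \<open>h\<close> reflections: even \<open>r\<close> for axes through two vertices, odd
  \<open>r\<close> for axes through two sides.\<close>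

lemma sum_card_fixed_flip_even:
  assumes n: "n = 2 * h" "h \<ge> 3"
  shows "(\<Sum>r<n. card (fixed_dissections n (n - 5) (flip n r))) =
    h * num_fan 1 0 h + h * (num_open 1 h + num_fan 1 1 (Suc h) + num_fan 3 0 (Suc h))"
proof -
  let ?f = "\<lambda>r. card (fixed_dissections n (n - 5) (flip n r))"
  have ev: "?f (2 * t) = num_open 1 h + num_fan 1 1 (Suc h) + num_fan 3 0 (Suc h)" if "t < h" for t
    using card_fixed_flip_conj[of 0 n "2 * t" t "n - 5"] card_fixed_flip_even_vertices[OF n] that n by simp
  have od: "?f (2 * t + 1) = num_fan 1 0 h" if "t < h" for t
  proof -
    have "2 * t + 1 < n" "n - 1 < n" "h - 1 - t < n" "2 * t + 1 + 2 * (h - 1 - t) = n - 1"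
      using that n by auto
    then show ?thesis
      using card_fixed_flip_conj[of "2 * t + 1" n "n - 1" "h - 1 - t" "n - 5"]
        card_fixed_flip_even_edges[OF n] by simp
  qed
  have "(\<Sum>r<2 * h. ?f r) = (\<Sum>t<h. ?f (2 * t) + ?f (2 * t + 1))"
    by (induction h) (simp_all add: algebra_simps)
  then show ?thesis using ev od n(1) by (simp add: sum.distrib)
qed

section \<open>Counting orbits\<close>

lemma catalan_of_nat: "catalan (real k) = real ((2 * k) choose k) / (real k + 1)"
  by (simp add: catalan_def)

lemma catalan_Suc: "(real k + 2) * catalan (real (Suc k)) = (4 * real k + 2) * catalan (real k)"
proof -
  \<comment> \<open>The odd-row coefficient \<open>q\<close> mediates between the two central
    binomial coefficients \<open>s\<close> and \<open>p\<close>.\<close>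
  define p q s where d: "p = (Suc (2 * k + 1) choose Suc k)" "q = (2 * k + 1 choose k)" "s = (2 * k choose k)"
  have "Suc (2 * k + 1) * q = p * Suc k"
    unfolding d by (rule Suc_times_binomial_eq)
  from arg_cong[OF this, of real] have 1: "2 * (real k + 1) * real q = real p * (real k + 1)"
    by (simp add: algebra_simps)
  have "(2 * k + 1 - k) * q = (2 * k + 1) * s"
    using binomial_absorb_comp[of "2 * k + 1" k] by (simp add: d)
  from arg_cong[OF this, of real] have 2: "(real k + 1) * real q = (2 * real k + 1) * real s"
    by (simp add: algebra_simps)
  have c: "catalan (real (Suc k)) = real p / (real k + 2)" "catalan (real k) = real s / (real k + 1)"
    unfolding catalan_of_nat d by (simp_all add: add.commute)
  have nz: "real k + 1 \<noteq> 0" "real k + 2 \<noteq> 0" by linarith+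
  have "real p * (real k + 1) = (4 * real k + 2) * real s" using 1 2 by algebra
  then have "real p = (4 * real k + 2) * real s / (real k + 1)" using nz by (simp add: field_simps)
  then show ?thesis unfolding c using nz by simp
qed

text \<open>Both sides start at 1 and satisfy the same first-order recursion.\<close>

lemma triang_eq_catalan: "triang (Suc k) = catalan (real k)"
proof (induction k)
  case 0
  show ?case using triang_1 by (simp add: catalan_of_nat[of 0, simplified])
next
  case (Suc k)
  have "(real k + 2) * triang (Suc (Suc k)) = (4 * real k + 2) * triang (Suc k)"
    using triang_rec[of "Suc k"] by (simp add: algebra_simps)
  also have "\<dots> = (real k + 2) * catalan (real (Suc k))" using catalan_Suc[of k] Suc by simp
  finally show ?case by (simp del: of_nat_Suc)
qed

lemma catalan_diff: "L \<ge> 1 \<Longrightarrow> catalan (real L - 1) = triang L"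
  using triang_eq_catalan[of "L - 1"] by (simp add: of_nat_diff)

text \<open>The value 0 of \<open>catalan\<close> off the naturals encodes divisibility, so a
  conditional term of the Burnside sum becomes a single formula.\<close>

lemma catalan_div:
  assumes "p > 0" "n > 0"
  shows "catalan (real n / real p - 1) = (if p dvd n then triang (n div p) else 0)"
proof (cases "p dvd n")
  case True
  then obtain m where m: "n = p * m" by blast
  then show ?thesis using assms catalan_diff[of m] by simp
next
  case False
  have "real n / real p - 1 \<notin> \<nat>"
  proof
    assume "real n / real p - 1 \<in> \<nat>"
    then obtain k where "real n / real p - 1 = real k" by (auto elim: Nats_cases)
    then have "real n = real (p * (k + 1))" using assms by (simp add: field_simps)
    then have "n = p * (k + 1)" by (simp only: of_nat_eq_iff)
    then show False using False by simp
  qed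
  then show ?thesis using False by (simp add: catalan_def)
qed

lemma triang_step: "L \<ge> 2 \<Longrightarrow> triang (L - 1) = real L * triang L / (4 * real L - 6)"
  using triang_rec[of "L - 1"] by (simp add: of_nat_diff field_simps)

theorem theorem3:
  fixes n :: nat
  assumes "n \<ge> 5"
  shows "real (card (orbits (rotation_group n) (dissections n (n - 5)) (dissection_action n (n - 5))))
           = (real n - 3)\<^sup>2 * (real n - 4) / (4 * real n * (2 * real n - 5)) * catalan (real n - 2)
             + (real n - 4) / 8 * catalan (real n / 2 - 1)
             + 4 / 5 * catalan (real n / 5 - 1)
         \<and> real (card (orbits (dihedral_group n) (dissections n (n - 5)) (dissection_action n (n - 5))))
           = (if even n then
                (real n - 3)\<^sup>2 * (real n - 4) / (8 * real n * (2 * real n - 5)) * catalan (real n - 2)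
                + 2 / 5 * catalan (real n / 5 - 1)
                + 3 * (real n - 4) * (real n - 1) / (16 * (real n - 3)) * catalan (real n / 2 - 1)
              else
                (real n - 3)\<^sup>2 * (real n - 4) / (8 * real n * (2 * real n - 5)) * catalan (real n - 2)
                + 2 / 5 * catalan (real n / 5 - 1)
                + ((real n)\<^sup>2 - 2 * real n - 11) / (8 * (real n - 4)) * catalan ((real n - 3) / 2))"
proof -
  let ?x = "real n"
  \<comment> \<open>The shares of the identity, the half turn and the four fifth turns in the
    Burnside sum: \<open>n\<close> times the three terms of the cyclic formula.\<close>
  define a where "a = (?x - 3)\<^sup>2 * (?x - 4) / (4 * (2 * ?x - 5)) * catalan (?x - 2)"
  define b where "b = ?x * ((?x - 4) / 8) * catalan (?x / 2 - 1)"
  define c where "c = ?x * (4 / 5) * catalan (?x / 5 - 1)"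
  define R where "R = (\<Sum>r<n. card (fixed_dissections n (n - 5) (rot n r)))"
  define F where "F = (\<Sum>r<n. card (fixed_dissections n (n - 5) (flip n r)))"
  have A1: "real (num_open 2 (n - 1)) = a"
  proof -
    have "catalan (?x - 2) = triang (n - 1)" using catalan_diff[of "n - 1"] assms by (simp add: of_nat_diff)
    moreover have "triang (n - 1 - 1) = (?x - 1) * triang (n - 1) / (4 * ?x - 10)"
      using triang_step[of "n - 1"] assms by (simp add: of_nat_diff)
    ultimately have "real (num_open 2 (n - 1)) = (?x - 2) * (?x - 3) / 2 * ((?x - 1) * catalan (?x - 2) / (4 * ?x - 10))
       - (2 * ?x - 5) * ((?x - 1) * catalan (?x - 2) / (4 * ?x - 10)) + catalan (?x - 2)"
      using num_open_2[of "n - 1"] assms by (simp add: of_nat_diff)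
    also have "\<dots> = a"
    proof -
      \<comment> \<open>With \<open>y\<close> for 2n - 5, all denominators become multiples of one
        nonzero variable, as 4n - 10 = 2y.\<close>
      define C y where "C = catalan (?x - 2)" and y: "y = 2 * ?x - 5"
      have x: "?x = (y + 5) / 2" "y \<noteq> 0" using assms by (auto simp: y)
      show ?thesis unfolding a_def C_def[symmetric] unfolding x(1)
        using x(2) by (simp add: field_simps power2_eq_square)
    qed
    finally show ?thesis .
  qed
  have A2: "real (if even n then n div 2 * num_open 1 (n div 2) else 0) = b"
  proof (cases "even n")
    case True
    then obtain h where h: "n = 2 * h" by blast
    have cat: "catalan (?x / 2 - 1) = triang h" using catalan_div[of 2 n] h assms by simp
    have "triang (h - 1) = real h * triang h / (4 * real h - 6)" using h assms by (intro triang_step) simp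
    then have "real (num_open 1 h) = (2 * real h - 3) * (real h * triang h / (4 * real h - 6)) - triang h"
      using num_open_1[of h] h assms by simp
    also have "\<dots> = (real h - 2) / 2 * triang h" using h assms by (simp add: field_simps)
    finally have eq: "real (num_open 1 h) = (real h - 2) / 2 * triang h" .
    have "real (if even n then n div 2 * num_open 1 (n div 2) else 0) = real h * real (num_open 1 h)"
      using h by simp
    also have "\<dots> = b" unfolding eq b_def cat using h by (simp add: field_simps)
    finally show ?thesis .
  next
    case False
    then show ?thesis unfolding b_def using catalan_div[of 2 n] assms by simp
  qed
  have A3: "real (if 5 dvd n then 4 * (n div 5 * num_closed 0 (n div 5)) else 0) = c"
  proof (cases "5 dvd n")
    case True
    then obtain m where m: "n = 5 * m" by blast
    then show ?thesis unfolding c_def using catalan_div[of 5 n] assms by (simp add: triang_def)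
  next
    case False
    then show ?thesis unfolding c_def using catalan_div[of 5 n] assms by simp
  qed
  have R: "real R = a + b + c"
    unfolding R_def sum_card_fixed_rot[OF assms] of_nat_add A1 A2 A3 ..
  have rot: "?x * real (card (orbits (rotation_group n) (dissections n (n - 5)) (dissection_action n (n - 5)))) = real R"
    using burnside_rotations[of n "n - 5"] assms unfolding R_def by (simp flip: of_nat_mult)
  have dih: "2 * ?x * real (card (orbits (dihedral_group n) (dissections n (n - 5)) (dissection_action n (n - 5))))
      = real R + real F"
    using arg_cong[OF burnside_dihedral[of n "n - 5"], of real] assms unfolding R_def F_def by simp
  have x0: "?x > 0" using assms by simp
  \<comment> \<open>The last term of the dihedral formula merges reflections and half turn;
    subtracting the share \<open>b\<close> of the half turn leaves the reflections. For odd
    \<open>n\<close> that share is 0.\<close>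
  have F_even: "real F = 2 * ?x * (3 * (?x - 4) * (?x - 1) / (16 * (?x - 3)) * catalan (?x / 2 - 1)) - b" if ev: "even n"
  proof -
    obtain h where h: "n = 2 * h" "h \<ge> 3" using ev assms by (auto elim!: evenE)
    have cat: "catalan (?x / 2 - 1) = triang h" using catalan_div[of 2 n] h assms by simp
    have Ah: "triang h = (4 * real h - 6) / real h * triang (h - 1)"
      using triang_step[of h] h by (simp add: field_simps)
    obtain l where l: "h = Suc l" "l \<ge> 2" using h by (cases h) auto
    have f: "real (num_fan 1 0 h) = triang (h - 1)" using num_fan_values(1)[of l] l by simp
    have "real (num_open 1 h + num_fan 1 1 (Suc h) + num_fan 3 0 (Suc h)) = (4 * real h - 9) * triang (h - 1)"
      using num_open_1[of h] num_fan_values(3,4)[of h] h by (simp add: algebra_simps)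
    then have "real F = real h * triang (h - 1) + real h * ((4 * real h - 9) * triang (h - 1))"
      unfolding F_def sum_card_fixed_flip_even[OF h] of_nat_add of_nat_mult f by simp
    also have "\<dots> = 2 * ?x * (3 * (?x - 4) * (?x - 1) / (16 * (?x - 3)) * catalan (?x / 2 - 1)) - b"
      unfolding b_def cat Ah using h by (simp add: field_simps)
    finally show ?thesis .
  qed
  have F_odd: "real F = 2 * ?x * ((?x\<^sup>2 - 2 * ?x - 11) / (8 * (?x - 4)) * catalan ((?x - 3) / 2))" if od: "odd n"
  proof -
    obtain h where h: "n = 2 * h + 1" "h \<ge> 2" using od assms by (auto elim!: oddE)
    have e: "(?x - 3) / 2 = real h - 1" using h by simp
    have cat: "catalan ((?x - 3) / 2) = triang h" unfolding e using catalan_diff[of h] h by simp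
    have s: "triang (h - 1) = real h * triang h / (4 * real h - 6)" using triang_step[of h] h by simp
    have "real (num_closed 1 h + num_fan 2 0 (Suc h)) = (2 * real h - 4) * triang (h - 1) + triang h"
      using num_closed_1[of h] num_fan_values(2)[of h] h by (simp add: algebra_simps)
    then have "real F = ?x * ((2 * real h - 4) * triang (h - 1) + triang h)"
      unfolding F_def sum_card_fixed_flip_odd[OF h] of_nat_mult by simp
    also have "\<dots> = 2 * ?x * ((?x\<^sup>2 - 2 * ?x - 11) / (8 * (?x - 4)) * catalan ((?x - 3) / 2))"
      unfolding cat s using h by (simp add: field_simps power2_eq_square)
    finally show ?thesis .
  qed
  show ?thesis
  proof (intro conjI)
    show "real (card (orbits (rotation_group n) (dissections n (n - 5)) (dissection_action n (n - 5))))
           = (real n - 3)\<^sup>2 * (real n - 4) / (4 * real n * (2 * real n - 5)) * catalan (real n - 2)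
             + (real n - 4) / 8 * catalan (real n / 2 - 1)
             + 4 / 5 * catalan (real n / 5 - 1)"
      (is "_ = ?rhs")
    proof -
      have "?x * ((?x - 3)\<^sup>2 * (?x - 4) / (4 * ?x * (2 * ?x - 5)) * catalan (?x - 2)) = a"
        using x0 by (simp add: a_def)
      then have "?x * ?rhs = a + b + c" unfolding distrib_left by (simp add: b_def c_def)
      from rot[unfolded R, folded this] show ?thesis
        by (rule mult_left_cancel[THEN iffD1, rotated]) (use x0 in simp)
    qed
    show "real (card (orbits (dihedral_group n) (dissections n (n - 5)) (dissection_action n (n - 5))))
           = (if even n then
                (real n - 3)\<^sup>2 * (real n - 4) / (8 * real n * (2 * real n - 5)) * catalan (real n - 2)
                + 2 / 5 * catalan (real n / 5 - 1)
                + 3 * (real n - 4) * (real n - 1) / (16 * (real n - 3)) * catalan (real n / 2 - 1)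
              else
                (real n - 3)\<^sup>2 * (real n - 4) / (8 * real n * (2 * real n - 5)) * catalan (real n - 2)
                + 2 / 5 * catalan (real n / 5 - 1)
                + ((real n)\<^sup>2 - 2 * real n - 11) / (8 * (real n - 4)) * catalan ((real n - 3) / 2))"
      (is "_ = ?rhs")
    proof -
      define y where y: "y = 2 * ?x - 5"
      have "y \<noteq> 0" using assms by (simp add: y)
      then have ac: "2 * ?x * ((?x - 3)\<^sup>2 * (?x - 4) / (8 * ?x * (2 * ?x - 5)) * catalan (?x - 2)) = a"
        "2 * ?x * (2 / 5 * catalan (?x / 5 - 1)) = c"
        unfolding a_def c_def y[symmetric] using x0 by (simp_all add: field_simps)
      have "2 * ?x * ?rhs = real R + real F"
      proof (cases "even n")
        case True
        then show ?thesis using ac F_even[OF True] R by (simp only: if_True distrib_left)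
      next
        case False
        moreover have "b = 0" unfolding b_def using False catalan_div[of 2 n] assms by simp
        ultimately show ?thesis using ac F_odd[OF False] R by (simp only: if_False distrib_left add_0_right)
      qed
      from dih[folded this] show ?thesis
        by (rule mult_left_cancel[THEN iffD1, rotated]) (use x0 in simp)
    qed
  qed
qed

end
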